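(* Let $a=(a_0,a_1,a_2,a_3)$ be generic complex parameters. The restriction $Z(a)$ of the system $Z_2(a)$ onto the line $t_2=1$ is the ordinary differential equation (with $t=t_1$, $\partial=d/dt$) given by $$Z(a)=p_0\partial^4+p_1\partial^3+p_2\partial^2+p_3\partial+p_4,$$ where \begin{align*} p_0&=2(t+1)^2(t-1)^3,\\ p_1&=-4(t+1)(t-1)^2\{(2+a_0)+(a_0-2)t\},\\ p_2&=2(t-1)\{(a_0^2-2a_1+6a_0+2+a_2+a_3)+(3a_0^2+4a_0-4+2a_1)t+(a_0^2-4a_0+2-a_2-a_3)t^2\},\\ p_3&=(-4a_0^2-8a_0+4a_0a_1+4a_1-(2a_0+4)(a_2+a_3))\\ &\quad+(-2a_0^3-6a_0^2-4a_0a_1-4a_1+4(a_2+a_3))t+2a_0(a_0+a_2+a_3)t^2,\\ p_4&=2a_2a_3t+(a_1-a_2-a_3)(a_0+2)^2-2a_2a_3. \end{align*} This equation has one accessory parameter: the local exponents do not change if a constant is added to $p_4$.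
   Context: With $\partial_i=\partial/\partial t_i$, $\partial_{ij}=\partial_i\partial_j$, $\partial_{ijk}=\partial_i\partial_j\partial_k$, the system $Z_2(a)$ in the variables $(t_1,t_2)$ is the left ideal generated by $$P_1=(1-t_1^2)\partial_{11}+2(1-t_1t_2)\partial_{12}+(1-t_2^2)\partial_{22}+a_0(t_1\partial_1+t_2\partial_2)+a_3,$$ $$P_2=2(t_1-t_2)\{(1-t_2^2)\partial_{122}+a_0t_2\partial_{12}+a_1\partial_1+(1-t_1^2)\partial_{112}+a_0t_1\partial_{12}+a_2\partial_2\}$$ $$\qquad-(2+a_0)\{(1-t_2^2)\partial_{22}+a_0t_2\partial_2+a_1-(1-t_1^2)\partial_{11}-a_0t_1\partial_1-a_2\}.$$ The restriction of $Z_2(a)$ onto the line $t_2=1$ is generated by the operators $P(t_1,\partial_1)$ such that $P(t_1,\partial_1)+(t_2-1)Q$ belongs to $Z_2(a)$ for some operator $Q=Q(t_1,t_2,\partial_1,\partial_2)$; "given by $Z(a)$" means that, as an ordinary differential equation (i.e. over rational functions of $t$), it is generated by the operator $Z(a)$. Generic means outside a countable union of proper algebraic hypersurfaces of the parameter space. *)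

theory Defs
  imports
    "HOL-Computational_Algebra.Polynomial"
    "HOL-Computational_Algebra.Polynomial_Factorial"
    "HOL-Library.Countable_Set"
begin

section \<open>Rings of differential operators\<close>

text \<open>
  Rings of differential operators over a commutative ring of functions \<open>'r\<close> of
  characteristic 0 are realised by their faithful action on \<open>'r\<close>: an operator is a map
  \<open>'r \<Rightarrow> 'r\<close>, and the product of operators is composition.
\<close>

inductive_set diff_ops :: "('r \<Rightarrow> 'r) set \<Rightarrow> ('r :: comm_ring_1 \<Rightarrow> 'r) set"
  for Ds :: "('r \<Rightarrow> 'r) set"
where
  mult: "(\<lambda>f. g * f) \<in> diff_ops Ds"
| deriv: "D \<in> Ds \<Longrightarrow> D \<in> diff_ops Ds"
| add: "A \<in> diff_ops Ds \<Longrightarrow> B \<in> diff_ops Ds \<Longrightarrow> (\<lambda>f. A f + B f) \<in> diff_ops Ds"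
| comp: "A \<in> diff_ops Ds \<Longrightarrow> B \<in> diff_ops Ds \<Longrightarrow> A \<circ> B \<in> diff_ops Ds"

inductive_set left_ideal :: "('r \<Rightarrow> 'r) set \<Rightarrow> ('r \<Rightarrow> 'r) set \<Rightarrow> ('r :: comm_ring_1 \<Rightarrow> 'r) set"
  for W S :: "('r \<Rightarrow> 'r) set"
where
  zero: "(\<lambda>_. 0) \<in> left_ideal W S"
| gen: "A \<in> S \<Longrightarrow> A \<in> left_ideal W S"
| add: "A \<in> left_ideal W S \<Longrightarrow> B \<in> left_ideal W S \<Longrightarrow> (\<lambda>f. A f + B f) \<in> left_ideal W S"
| lmult: "A \<in> W \<Longrightarrow> B \<in> left_ideal W S \<Longrightarrow> A \<circ> B \<in> left_ideal W S"


section \<open>The system in two variables\<close>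

text \<open>
  \<open>\<complex>[t\<^sub>1,t\<^sub>2]\<close> is \<open>\<complex>[t\<^sub>1][t\<^sub>2]\<close>: the inner polynomial variable is \<open>t\<^sub>1\<close>, the outer one \<open>t\<^sub>2\<close>.
\<close>

type_synonym poly2 = "complex poly poly"

definition t1 :: poly2 where "t1 = [:[:0, 1:]:]"
definition t2 :: poly2 where "t2 = [:0, 1:]"
definition cst :: "complex \<Rightarrow> poly2" where "cst c = [:[:c:]:]"

definition d1 :: "poly2 \<Rightarrow> poly2" where "d1 = map_poly pderiv"
definition d2 :: "poly2 \<Rightarrow> poly2" where "d2 = pderiv"

definition weyl2 :: "(poly2 \<Rightarrow> poly2) set" where
  "weyl2 = diff_ops {d1, d2}"

definition P1 :: "complex \<Rightarrow> complex \<Rightarrow> complex \<Rightarrow> complex \<Rightarrow> poly2 \<Rightarrow> poly2" where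
  "P1 a0 a1 a2 a3 f =
     (1 - t1^2) * d1 (d1 f) + 2 * (1 - t1 * t2) * d1 (d2 f) + (1 - t2^2) * d2 (d2 f)
     + cst a0 * (t1 * d1 f + t2 * d2 f) + cst a3 * f"

definition P2 :: "complex \<Rightarrow> complex \<Rightarrow> complex \<Rightarrow> complex \<Rightarrow> poly2 \<Rightarrow> poly2" where
  "P2 a0 a1 a2 a3 f =
     2 * (t1 - t2) *
       ((1 - t2^2) * d1 (d2 (d2 f)) + cst a0 * t2 * d1 (d2 f) + cst a1 * d1 f
        + (1 - t1^2) * d1 (d1 (d2 f)) + cst a0 * t1 * d1 (d2 f) + cst a2 * d2 f)
     - cst (2 + a0) *
       ((1 - t2^2) * d2 (d2 f) + cst a0 * t2 * d2 f + cst a1 * f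
        - (1 - t1^2) * d1 (d1 f) - cst a0 * t1 * d1 f - cst a2 * f)"

definition Z2 :: "complex \<Rightarrow> complex \<Rightarrow> complex \<Rightarrow> complex \<Rightarrow> (poly2 \<Rightarrow> poly2) set" where
  "Z2 a0 a1 a2 a3 = left_ideal weyl2 {P1 a0 a1 a2 a3, P2 a0 a1 a2 a3}"


section \<open>Ordinary differential operators and restriction\<close>

text \<open>
  An ordinary differential operator \<open>p\<^sub>0(t) + p\<^sub>1(t) \<partial> + \<dots> + p\<^sub>n(t) \<partial>\<^sup>n\<close> with polynomial
  coefficients is given by its coefficients: here the outer polynomial variable stands for
  \<open>\<partial>\<close> and the inner one for \<open>t\<close>. Only the additive structure of this type agrees with that
  of operators. It acts as \<open>P(t\<^sub>1, \<partial>\<^sub>1)\<close> on \<open>\<complex>[t\<^sub>1,t\<^sub>2]\<close> and as \<open>P(t, d/dt)\<close> on \<open>\<complex>(t)\<close>.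
\<close>

type_synonym ode = "complex poly poly"

definition op_t1 :: "ode \<Rightarrow> poly2 \<Rightarrow> poly2" where
  "op_t1 P f = (\<Sum>i\<le>degree P. [:coeff P i:] * (d1 ^^ i) f)"

definition restriction :: "complex \<Rightarrow> complex \<Rightarrow> complex \<Rightarrow> complex \<Rightarrow> ode set" where
  "restriction a0 a1 a2 a3 =
     {P. \<exists>Q\<in>weyl2. (\<lambda>f. op_t1 P f + (t2 - 1) * Q f) \<in> Z2 a0 a1 a2 a3}"

type_synonym ratfun = "complex poly fract"

definition rat_deriv :: "ratfun \<Rightarrow> ratfun" where
  "rat_deriv q = (THE r. \<forall>a b. b \<noteq> 0 \<longrightarrow> q = Fract a b \<longrightarrow>
     r = Fract (pderiv a * b - a * pderiv b) (b\<^sup>2))"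

lemma rat_deriv_Fract:
  assumes "b \<noteq> 0"
  shows "rat_deriv (Fract a b) = Fract (pderiv a * b - a * pderiv b) (b\<^sup>2)"
  unfolding rat_deriv_def
proof (rule the_equality, intro allI impI)
  fix c d
  assume d: "d \<noteq> 0" and "Fract a b = Fract c d"
  then have e: "a * d = c * b"
    using assms by (simp add: eq_fract)
  then have "pderiv (a * d) = pderiv (c * b)"
    by simp
  then have "a * pderiv d + d * pderiv a = c * pderiv b + b * pderiv c"
    by (simp add: pderiv_mult)
  with e have "(pderiv a * b - a * pderiv b) * d\<^sup>2 = (pderiv c * d - c * pderiv d) * b\<^sup>2"
    by algebra
  then show "Fract (pderiv a * b - a * pderiv b) (b\<^sup>2) = Fract (pderiv c * d - c * pderiv d) (d\<^sup>2)"
    using assms d by (simp add: eq_fract)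
next
  fix r
  assume "\<forall>c d. d \<noteq> 0 \<longrightarrow> Fract a b = Fract c d \<longrightarrow>
    r = Fract (pderiv c * d - c * pderiv d) (d\<^sup>2)"
  then show "r = Fract (pderiv a * b - a * pderiv b) (b\<^sup>2)"
    using assms by blast
qed

definition rat_ops :: "(ratfun \<Rightarrow> ratfun) set" where
  "rat_ops = diff_ops {rat_deriv}"

definition op_rat :: "ode \<Rightarrow> ratfun \<Rightarrow> ratfun" where
  "op_rat P f = (\<Sum>i\<le>degree P. to_fract (coeff P i) * (rat_deriv ^^ i) f)"

definition Z :: "complex \<Rightarrow> complex \<Rightarrow> complex \<Rightarrow> complex \<Rightarrow> ode" where
  "Z a0 a1 a2 a3 = (
     let t = [:0, 1:];
       p0 = 2 * (t + 1)^2 * (t - 1)^3;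
       p1 = - 4 * (t + 1) * (t - 1)^2 * ([:2 + a0:] + [:a0 - 2:] * t);
       p2 = 2 * (t - 1) *
         ([:a0^2 - 2*a1 + 6*a0 + 2 + a2 + a3:]
          + [:3*a0^2 + 4*a0 - 4 + 2*a1:] * t
          + [:a0^2 - 4*a0 + 2 - a2 - a3:] * t^2);
       p3 = [:- 4*a0^2 - 8*a0 + 4*a0*a1 + 4*a1 - (2*a0 + 4) * (a2 + a3):]
          + [:- 2*a0^3 - 6*a0^2 - 4*a0*a1 - 4*a1 + 4 * (a2 + a3):] * t
          + [:2*a0 * (a0 + a2 + a3):] * t^2;
       p4 = [:2*a2*a3:] * t + [:(a1 - a2 - a3) * (a0 + 2)^2 - 2*a2*a3:]
     in [:p4, p3, p2, p1, p0:])"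


section \<open>Local exponents\<close>

text \<open>The falling factorial \<open>s (s - 1) \<dots> (s - i + 1)\<close> as a polynomial in \<open>s\<close>.\<close>

definition falling :: "nat \<Rightarrow> complex poly" where
  "falling i = (\<Prod>j<i. [:- of_nat j, 1:])"

text \<open>
  With \<open>n = degree L\<close>, the polynomial \<open>frobenius L x k\<close> in \<open>s\<close> is the coefficient of
  \<open>(t - x)\<^bsup>s + k - n\<^esup>\<close> in the expansion of \<open>L (t - x)\<^bsup>s\<^esup>\<close> at \<open>t = x\<close>.
\<close>

definition frobenius :: "ode \<Rightarrow> complex \<Rightarrow> nat \<Rightarrow> complex poly" where
  "frobenius L x k = (\<Sum>i\<le>degree L.
     if degree L \<le> k + i
     then smult (coeff (pcompose (coeff L i) [:x, 1:]) (k + i - degree L)) (falling i) else 0)"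

text \<open>
  At a finite point the indicial polynomial is the lowest nonzero coefficient. At infinity
  the exponent \<open>s\<close> belongs to \<open>t\<^bsup>-s\<^esup>\<close>, and the indicial polynomial is the highest nonzero
  coefficient of \<open>L t\<^bsup>-s\<^esup>\<close>. Exponents are counted with multiplicity.
\<close>

definition indicial :: "ode \<Rightarrow> complex \<Rightarrow> complex poly" where
  "indicial L x = frobenius L x (LEAST k. frobenius L x k \<noteq> 0)"

definition indicial_infinity :: "ode \<Rightarrow> complex poly" where
  "indicial_infinity L =
     pcompose (frobenius L 0 (GREATEST k. frobenius L 0 k \<noteq> 0)) [:0, -1:]"

definition local_exponents :: "ode \<Rightarrow> complex \<Rightarrow> complex multiset" where
  "local_exponents L x = proots (indicial L x)"

definition local_exponents_infinity :: "ode \<Rightarrow> complex multiset" where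
  "local_exponents_infinity L = proots (indicial_infinity L)"

text \<open>
  Fuchs' criterion, with \<open>n = degree L\<close> and \<open>p\<^sub>i = coeff L i\<close>: at every finite point the
  pole of \<open>p\<^sub>i / p\<^sub>n\<close> has order at most \<open>n - i\<close>, and at infinity \<open>p\<^sub>i / p\<^sub>n = O(t\<^bsup>i - n\<^esup>)\<close>.
\<close>

definition fuchsian :: "ode \<Rightarrow> bool" where
  "fuchsian L \<longleftrightarrow> L \<noteq> 0 \<and> (\<forall>i\<le>degree L. coeff L i \<noteq> 0 \<longrightarrow>
     (\<forall>x. order x (lead_coeff L) \<le> order x (coeff L i) + (degree L - i)) \<and>
     degree (coeff L i) + (degree L - i) \<le> degree (lead_coeff L))"


section \<open>Generic parameters\<close>

text \<open>
  Polynomials in \<open>a\<^sub>0, a\<^sub>1, a\<^sub>2, a\<^sub>3\<close> are iterated univariate polynomials, \<open>a\<^sub>0\<close> being the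
  outermost variable. A property is generic if it holds outside the zero sets of countably
  many nonzero polynomials.
\<close>

definition eval4 :: "complex poly poly poly poly \<Rightarrow> complex \<Rightarrow> complex \<Rightarrow> complex \<Rightarrow> complex \<Rightarrow> complex" where
  "eval4 F a0 a1 a2 a3 = poly (poly (poly (poly F [:[:[:a0:]:]:]) [:[:a1:]:]) [:a2:]) a3"

definition generically :: "(complex \<Rightarrow> complex \<Rightarrow> complex \<Rightarrow> complex \<Rightarrow> bool) \<Rightarrow> bool" where
  "generically R \<longleftrightarrow> (\<exists>S. countable S \<and> 0 \<notin> S \<and>
     (\<forall>a0 a1 a2 a3. (\<forall>F\<in>S. eval4 F a0 a1 a2 a3 \<noteq> 0) \<longrightarrow> R a0 a1 a2 a3))"

end

(*
  The operators P1 and P2 commute. With s = t2 - 1, write a solution as F = sum_k u_k(t) s^k; in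
  P1 F = P2 F = 0 the coefficient of s^k involves u_(k+1) through a first order operator in t for
  P1 and a second order one for P2. A combination of the two is multiplication of u_(k+1) by
  (t - 1) kappa_k, with a constant kappa_k that is nonzero for generic parameters. For k = 0,
  eliminating u_1 from the two equations leaves exactly Z(a) u_0 = 0, so Z(a) lies in the
  restriction. Conversely, let u_0 be a power series solution of Z(a). Solving the combined
  equation for u_1, u_2, ... gives F, and the relation P1 P2 = P2 P1 forces both equations to hold
  for all k. Hence every P in the restriction annihilates all solutions of Z(a) at the ordinary
  point t = 0, and division with remainder makes it a left multiple of Z(a) over the rational
  functions. The statement on exponents holds for all parameters: a constant added to p4 only
  changes the coefficient with k = 4 in the expansion of Z(a) (t - x)^s, whereas the indicial
  polynomials have k <= 3 at finite points and k = 5 at infinity.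
*)

theory Submission
  imports
    Defs
    "HOL-Computational_Algebra.Formal_Power_Series"
    "HOL-Computational_Algebra.Polynomial_FPS"
begin

unbundle fps_syntax

section \<open>Ordinary differential operators on differential rings\<close>

text \<open>The remainder in \<open>lead2_plus_cofactor_lead1\<close> is multiplication by this
  constant times \<open>x - 1\<close>; its nonvanishing for all k is the genericity
  condition.\<close>

definition kappa :: "complex \<Rightarrow> complex \<Rightarrow> nat \<Rightarrow> complex" where
  "kappa a0 a2 k = 4 * a2 + (a0 - 2 * of_nat k) * (a0 + 2 * of_nat k + 2)"

text \<open>The same identities are needed in three rings: \<open>poly2\<close> with
  \<open>d1\<close>, rational functions with \<open>rat_deriv\<close>, and power series with
  \<open>fps_deriv\<close>. The map \<open>h\<close> inserts polynomials in t as
  coefficients.\<close>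

locale diff_action =
  fixes h :: "complex poly \<Rightarrow> 'r :: idom" and D :: "'r \<Rightarrow> 'r"
  assumes h_add: "h (p + q) = h p + h q"
    and h_mult: "h (p * q) = h p * h q"
    and h_1: "h 1 = 1"
    and D_add: "D (f + g) = D f + D g"
    and D_mult: "D (f * g) = D f * g + f * D g"
    and D_h: "D (h p) = h (pderiv p)"
begin

lemma h_0 [simp]: "h 0 = 0"
  using h_add[of 0 0] by (metis add.right_neutral add_left_cancel)

lemma h_minus: "h (- p) = - h p"
  using h_add[of p "- p"] by (simp add: eq_neg_iff_add_eq_0 add.commute)

lemma h_diff: "h (p - q) = h p - h q"
  using h_add[of p "- q"] by (simp add: h_minus)

lemma h_power: "h (p ^ n) = h p ^ n"
  by (induction n) (simp_all add: h_1 h_mult)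

lemma h_of_nat: "h (of_nat n) = of_nat n"
  by (induction n) (simp_all add: h_1 h_add)

lemma h_numeral: "h (numeral n) = numeral n"
  using h_of_nat[of "numeral n"] by simp

lemma D_0 [simp]: "D 0 = 0"
  using D_add[of 0 0] by (metis add.right_neutral add_left_cancel)

lemma D_minus: "D (- f) = - D f"
  using D_add[of f "- f"] by (simp add: eq_neg_iff_add_eq_0 add.commute)

lemma D_diff: "D (f - g) = D f - D g"
  using D_add[of f "- g"] by (simp add: D_minus)

lemma D_1 [simp]: "D 1 = 0"
  using D_mult[of 1 1] by (metis add.right_neutral add_left_cancel mult_1 mult_1_right)

lemma D_of_nat [simp]: "D (of_nat n) = 0"
  by (induction n) (simp_all add: D_add)

lemma D_numeral [simp]: "D (numeral n) = 0"
  using D_of_nat[of "numeral n"] by simp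

lemma D_sum: "D (\<Sum>i\<in>I. f i) = (\<Sum>i\<in>I. D (f i))"
  by (induction I rule: infinite_finite_induct) (simp_all add: D_add)

definition act :: "ode \<Rightarrow> 'r \<Rightarrow> 'r" where
  "act L f = (\<Sum>i\<le>degree L. h (coeff L i) * (D ^^ i) f)"

lemma act_upto:
  assumes "degree L \<le> n"
  shows "act L f = (\<Sum>i\<le>n. h (coeff L i) * (D ^^ i) f)"
  unfolding act_def
  by (rule sum.mono_neutral_left) (use assms in \<open>auto simp: coeff_eq_0\<close>)

lemma act_0 [simp]: "act 0 f = 0"
  by (simp add: act_def)

lemma act_add: "act (L + M) f = act L f + act M f"
proof -
  define n where "n = max (degree L) (degree M)"
  have "degree (L + M) \<le> n" "degree L \<le> n" "degree M \<le> n"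
    using degree_add_le_max[of L M] by (auto simp: n_def)
  then show ?thesis
    by (simp add: act_upto h_add sum.distrib distrib_right)
qed

lemma act_smult: "act (smult q L) f = h q * act L f"
  by (simp add: act_upto[of _ "degree L"] h_mult sum_distrib_left mult.assoc)

lemma act_pCons: "act (pCons q L) f = h q * f + act L (D f)"
proof -
  have "degree (pCons q L) \<le> Suc (degree L)"
    by (rule degree_pCons_le)
  then have "act (pCons q L) f = (\<Sum>i\<le>Suc (degree L). h (coeff (pCons q L) i) * (D ^^ i) f)"
    by (rule act_upto)
  also have "\<dots> = h q * f + (\<Sum>i\<le>degree L. h (coeff L i) * (D ^^ i) (D f))"
    by (simp only: sum.atMost_Suc_shift) (simp add: funpow_swap1)
  finally show ?thesis
    by (simp add: act_def)
qed

lemma act_add_right: "act L (f + g) = act L f + act L g"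
proof -
  have "(D ^^ i) (f + g) = (D ^^ i) f + (D ^^ i) g" for i
    by (induction i) (simp_all add: D_add)
  then show ?thesis
    by (simp add: act_def distrib_left sum.distrib)
qed

text \<open>By the Leibniz rule, D q D^i = q' D^i + q D^(i+1), so this coefficient list represents
  the operator product D L.\<close>

lemma act_deriv_comp: "act (map_poly pderiv L + pCons 0 L) f = D (act L f)"
proof (induction L arbitrary: f)
  case (pCons q L)
  have "act (map_poly pderiv (pCons q L) + pCons 0 (pCons q L)) f
      = h (pderiv q) * f + h q * D f + act (map_poly pderiv L + pCons 0 L) (D f)"
    by (simp add: map_poly_pCons act_add act_pCons algebra_simps)
  then show ?case
    by (simp add: pCons.IH act_pCons D_add D_mult D_h)
qed simp

definition x :: 'r where "x = h [:0, 1:]"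

definition c :: "complex \<Rightarrow> 'r" where "c a = h [:a:]"

lemma c_simps [simp]:
  "c 0 = 0" "c 1 = 1" "c (numeral n) = numeral n" "c (of_nat m) = of_nat m"
  "c (a + b) = c a + c b" "c (a - b) = c a - c b" "c (- a) = - c a"
  "c (a * b) = c a * c b" "c (a ^ m) = c a ^ m"
proof -
  have *: "[:a * b:] = [:a:] * [:b:]" "[:a + b:] = [:a:] + [:b:]" "[:- a:] = - [:a:]" "[:a - b:] = [:a:] - [:b:]"
    for a b :: complex by simp_all
  show 0: "c 0 = 0" and 1: "c 1 = 1"
    unfolding c_def using h_0 h_1 by (simp_all only: one_pCons pCons_0_0)
  show m: "c (a * b) = c a * c b" for a b by (simp only: c_def * h_mult)
  show "c (a + b) = c a + c b" "c (a - b) = c a - c b" "c (- a) = - c a"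
    by (simp_all only: c_def * h_add h_minus h_diff)
  show "c (numeral n) = numeral n" unfolding c_def by (metis numeral_poly h_numeral)
  show "c (of_nat m) = of_nat m" unfolding c_def by (metis of_nat_poly h_of_nat)
  show "c (a ^ m) = c a ^ m"
    by (induction m) (simp_all only: power_0 power_Suc 1 m)
qed

lemma D_x [simp]: "D x = 1"
  by (simp add: x_def D_h pderiv_pCons h_1 flip: one_pCons)

lemma D_c [simp]: "D (c a) = 0"
  by (simp add: c_def D_h pderiv_pCons)

lemma D_square: "D (f\<^sup>2) = 2 * f * D f"
  by (simp add: power2_eq_square D_mult algebra_simps)

lemmas D_simps = D_add D_diff D_minus D_mult D_square

text \<open>
  If \<open>u s\<^bsup>k+1\<^esup>\<close> is the lowest term of a series in \<open>s = t\<^sub>2 - 1\<close>, then \<open>(k + 1) lead1 k u\<close> and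
  \<open>(k + 1) lead2 k u\<close> are the coefficients of \<open>s\<^bsup>k\<^esup>\<close> in its images under \<open>P\<^sub>1\<close> and \<open>P\<^sub>2\<close>.
\<close>

definition lead1 :: "complex \<Rightarrow> nat \<Rightarrow> 'r \<Rightarrow> 'r" where
  "lead1 a0 k v = 2 * (1 - x) * D v + (c a0 - 2 * of_nat k) * v"

definition lead2 :: "complex \<Rightarrow> complex \<Rightarrow> nat \<Rightarrow> 'r \<Rightarrow> 'r" where
  "lead2 a0 a2 k v = 2 * (x - 1) * ((1 - x\<^sup>2) * D (D v) + (c a0 - 2 * of_nat k + c a0 * x) * D v + c a2 * v)
     - (2 + c a0) * (c a0 - 2 * of_nat k) * v"

definition cofactor :: "complex \<Rightarrow> nat \<Rightarrow> 'r \<Rightarrow> 'r" where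
  "cofactor a0 k v = 2 * (1 - x\<^sup>2) * D v
     + (c a0 - 2 * of_nat k + 2 + x * (c a0 + 2 * of_nat k + 2)) * v"

text \<open>Right division of \<open>2 lead2\<close> by \<open>lead1\<close>: the quotient is
  \<open>- cofactor\<close> and the remainder has order zero. So v is determined without solving a
  differential equation in t.\<close>

lemma lead2_plus_cofactor_lead1:
  "2 * lead2 a0 a2 k v + cofactor a0 k (lead1 a0 k v) = c (kappa a0 a2 k) * (x - 1) * v"
  unfolding lead2_def cofactor_def lead1_def kappa_def
  by (simp add: D_simps) algebra

text \<open>The same division with the factors in the other order, which shifts the index of
  \<open>cofactor\<close> and \<open>kappa\<close> to k + 1. This is the form needed when P1 P2 = P2
  P1 is compared at the lowest power of s.\<close>

lemma lead2_plus_lead1_cofactor: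
  "2 * lead2 a0 a2 k v + lead1 a0 k (cofactor a0 (Suc k) v) = c (kappa a0 a2 (Suc k)) * (x - 1) * v"
  unfolding lead2_def cofactor_def lead1_def kappa_def
  by (simp add: D_simps) algebra

text \<open>
  These are \<open>P\<^sub>1\<close> and \<open>P\<^sub>2\<close> on the line \<open>t\<^sub>2 = 1\<close>, where \<open>u\<close> and \<open>v\<close> are the restrictions of a
  function and of its \<open>t\<^sub>2\<close>-derivative. Second and higher \<open>t\<^sub>2\<close>-derivatives drop out there, because
  they are multiplied by \<open>1 - t\<^sub>2\<^sup>2\<close>.
\<close>

definition restr1 :: "complex \<Rightarrow> complex \<Rightarrow> 'r \<Rightarrow> 'r \<Rightarrow> 'r" where
  "restr1 a0 a3 u v = (1 - x\<^sup>2) * D (D u) + c a0 * x * D u + c a3 * u + lead1 a0 0 v"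

definition restr2 :: "complex \<Rightarrow> complex \<Rightarrow> complex \<Rightarrow> 'r \<Rightarrow> 'r \<Rightarrow> 'r" where
  "restr2 a0 a1 a2 u v = 2 * (x - 1) * c a1 * D u
     - (2 + c a0) * ((c a1 - c a2) * u - (1 - x\<^sup>2) * D (D u) - c a0 * x * D u) + lead2 a0 a2 0 v"

lemma act_Z:
  "act (Z a0 a1 a2 a3) f =
     2 * (x + 1)^2 * (x - 1)^3 * D (D (D (D f)))
     - 4 * (x + 1) * (x - 1)^2 * (2 + c a0 + (c a0 - 2) * x) * D (D (D f))
     + 2 * (x - 1) *
         (c a0^2 - 2*c a1 + 6*c a0 + 2 + c a2 + c a3
          + (3*c a0^2 + 4*c a0 - 4 + 2*c a1) * x
          + (c a0^2 - 4*c a0 + 2 - c a2 - c a3) * x^2) * D (D f)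
     + (- 4*c a0^2 - 8*c a0 + 4*c a0*c a1 + 4*c a1 - (2*c a0 + 4) * (c a2 + c a3)
          + (- 2*c a0^3 - 6*c a0^2 - 4*c a0*c a1 - 4*c a1 + 4 * (c a2 + c a3)) * x
          + (2*c a0 * (c a0 + c a2 + c a3)) * x^2) * D f
     + (2*c a2*c a3 * x + (c a1 - c a2 - c a3) * (c a0 + 2)^2 - 2*c a2*c a3) * f"
  unfolding Z_def Let_def act_pCons act_0 h_add h_mult h_power h_diff h_minus h_numeral h_1
    x_def[symmetric] c_def[symmetric] c_simps
  by algebra

text \<open>
  The terms in \<open>v\<close> cancel: by \<open>lead2_plus_cofactor_lead1\<close>, \<open>v\<close> enters the combination
  \<open>2 restr2 + cofactor restr1\<close> only through \<open>kappa (x - 1) v\<close>.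
\<close>

lemma two_act_Z:
  "2 * act (Z a0 a1 a2 a3) u =
     c (kappa a0 a2 0) * (x - 1) * restr1 a0 a3 u v
     - (lead1 a0 0 (2 * restr2 a0 a1 a2 u v + cofactor a0 0 (restr1 a0 a3 u v))
        + 2 * (2 * restr2 a0 a1 a2 u v + cofactor a0 0 (restr1 a0 a3 u v)))"
  \<comment> \<open>The second summand with factor 2 corrects a commutator: lead1 ((x - 1) v) + 2 (x
    - 1) v = (x - 1) lead1 v, which is what \<open>restr1\<close> contributes in v.\<close>
  unfolding act_Z restr1_def restr2_def lead2_def cofactor_def lead1_def kappa_def
  by (simp add: D_simps) algebra

end

section \<open>The three differential rings: polynomials, rational functions, power series\<close>

lemma d1_pCons [simp]: "d1 (pCons p f) = pCons (pderiv p) (d1 f)"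
  by (simp add: d1_def map_poly_pCons)

lemma d1_0 [simp]: "d1 0 = 0"
  by (simp add: d1_def)

lemma coeff_d1: "coeff (d1 f) n = pderiv (coeff f n)"
  by (simp add: d1_def coeff_map_poly)

lemma d1_add: "d1 (f + g) = d1 f + d1 g"
  by (simp add: poly_eq_iff coeff_d1 pderiv_add)

lemma d1_smult: "d1 (smult p f) = smult (pderiv p) f + smult p (d1 f)"
  by (simp add: poly_eq_iff coeff_d1 pderiv_mult algebra_simps)

lemma d1_mult: "d1 (f * g) = d1 f * g + f * d1 g"
  by (induction f) (simp_all add: d1_add d1_smult algebra_simps)

lemma rat_deriv_add: "rat_deriv (f + g) = rat_deriv f + rat_deriv g"
proof (cases f; cases g)
  fix a b p q
  assume [simp]: "f = Fract a b" "b \<noteq> 0" "g = Fract p q" "q \<noteq> 0"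
  show ?thesis
    by (simp add: rat_deriv_Fract eq_fract pderiv_add pderiv_mult) algebra
qed

lemma rat_deriv_mult: "rat_deriv (f * g) = rat_deriv f * g + f * rat_deriv g"
proof (cases f; cases g)
  fix a b p q
  assume [simp]: "f = Fract a b" "b \<noteq> 0" "g = Fract p q" "q \<noteq> 0"
  show ?thesis
    by (simp add: rat_deriv_Fract eq_fract pderiv_mult) algebra
qed

lemma rat_deriv_to_fract: "rat_deriv (to_fract p) = to_fract (pderiv p)"
  using rat_deriv_Fract[of 1 p] by (simp add: to_fract_def)

interpretation pol: diff_action "\<lambda>p. [:p:]" d1
  by unfold_locales (simp_all add: d1_add d1_mult one_pCons)

interpretation rat: diff_action to_fract rat_deriv
  by unfold_locales (simp_all add: rat_deriv_add rat_deriv_mult rat_deriv_to_fract)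

interpretation ser: diff_action "fps_of_poly :: complex poly \<Rightarrow> complex fps" fps_deriv
  by unfold_locales
    (simp_all add: fps_of_poly_add fps_of_poly_mult fps_of_poly_pderiv algebra_simps)

lemma op_t1_eq_act: "op_t1 = pol.act"
  by (simp add: fun_eq_iff op_t1_def pol.act_def)

lemma op_rat_eq_act: "op_rat = rat.act"
  by (simp add: fun_eq_iff op_rat_def rat.act_def)

section \<open>Left multiples and formal solutions\<close>

text \<open>A triangular system is solved one coefficient at a time: by additivity and
  \<open>lead\<close>, the k-th equation involves only coefficients up to k + n, and the last one
  enters through the surjective \<open>\<phi> k\<close>. Used for n the order of an ODE in t, and
  for n = 1 in powers of s.\<close>

lemma graded_solution_exists:
  fixes T :: "'a::ab_group_add fps \<Rightarrow> nat \<Rightarrow> 'a"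
  assumes add: "\<And>F G k. T (F + G) k = T F k + T G k"
    and lead: "\<And>H k. (\<And>j. j < k + n \<Longrightarrow> H $ j = 0) \<Longrightarrow> T H k = \<phi> k (H $ (k + n))"
    and surj: "\<And>k. surj (\<phi> k)"
  shows "\<exists>F. (\<forall>j<n. F $ j = c j) \<and> (\<forall>k. T F k = 0)"
proof -
  have T0: "T 0 k = 0" for k
    using add[of 0 0 k] by simp
  then have \<phi>0: "\<phi> k 0 = 0" for k
    using lead[of k 0] by simp
  define v where "v k F = inv (\<phi> k) (- T F k)" for k F
  have v: "\<phi> k (v k F) = - T F k" for k F
    unfolding v_def by (rule surj_f_inv_f[OF surj])
  define S where "S = rec_nat (Abs_fps c)
    (\<lambda>k F. F + Abs_fps (\<lambda>j. if j = k + n then v k F else 0))"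
  have S0: "S 0 = Abs_fps c"
    and S_Suc: "S (Suc k) = S k + Abs_fps (\<lambda>j. if j = k + n then v k (S k) else 0)" for k
    by (simp_all only: S_def nat.rec)
  have stable: "S (m + d) $ j = S m $ j" if "j < m + n" for m d j
    using that by (induction d) (simp_all add: S_Suc)
  \<comment> \<open>Stage m fixes all coefficients below m + n, so stage j + 1 already has the final
    coefficient j, even for n = 0.\<close>
  define F where "F = Abs_fps (\<lambda>j. S (Suc j) $ j)"
  have F: "F $ j = S m $ j" if "j < m + n" for m j
  proof (cases "m \<le> Suc j")
    case True
    then show ?thesis
      using stable[of j m "Suc j - m"] that by (simp add: F_def)
  next
    case False
    then show ?thesis
      using stable[of j "Suc j" "m - Suc j"] by (simp add: F_def)
  qed
  have "T F k = 0" for k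
  proof -
    have "T F k = T (S (Suc k)) k + T (F - S (Suc k)) k"
      by (simp flip: add)
    also have "T (F - S (Suc k)) k = \<phi> k 0"
      using lead[of k "F - S (Suc k)"] F[of _ "Suc k"] by simp
    also have "T (S (Suc k)) k = T (S k) k + \<phi> k (v k (S k))"
      by (simp add: S_Suc add lead)
    finally show ?thesis
      by (simp add: v \<phi>0)
  qed
  moreover have "F $ j = c j" if "j < n" for j
    using F[of j 0] that by (simp add: S0)
  ultimately show ?thesis
    by blast
qed

lemma fps_deriv_funpow_nth:
  fixes f :: "'a::{comm_ring_1, ring_char_0} fps"
  shows "(fps_deriv ^^ i) f $ j = pochhammer (of_nat (Suc j)) i * f $ (i + j)"
  by (induction i arbitrary: j) (simp_all add: pochhammer_rec algebra_simps)

text \<open>The point t = 0 is ordinary. In the coefficient of t^k, terms of order i < n involve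
  coefficients of u below k + n only, so the leading term determines the coefficient k + n.\<close>

lemma ode_solution_exists:
  assumes "coeff (lead_coeff L) 0 \<noteq> 0"
  shows "\<exists>u. (\<forall>j<degree L. u $ j = c j) \<and> ser.act L u = 0"
proof -
  define n where "n = degree L"
  define \<phi> :: "nat \<Rightarrow> complex \<Rightarrow> complex" where
    "\<phi> k = (\<lambda>v. coeff (lead_coeff L) 0 * pochhammer (of_nat (Suc k)) n * v)" for k
  have "\<exists>u. (\<forall>j<n. u $ j = c j) \<and> (\<forall>k. ser.act L u $ k = 0)"
  proof (rule graded_solution_exists[where \<phi> = \<phi>])
    fix H :: "complex fps" and k
    assume H: "\<And>j. j < k + n \<Longrightarrow> H $ j = 0"
    have D0: "(fps_deriv ^^ i) H $ j = 0" if "i + j < k + n" for i j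
      using H[OF that] by (simp add: fps_deriv_funpow_nth)
    have "(fps_of_poly (coeff L i) * (fps_deriv ^^ i) H) $ k = 0" if "i < n" for i
      using that by (auto simp: fps_mult_nth intro!: sum.neutral disjI2 D0)
    then have "ser.act L H $ k = (fps_of_poly (lead_coeff L) * (fps_deriv ^^ n) H) $ k"
      by (simp add: ser.act_def fps_sum_nth n_def lessThan_Suc_atMost[symmetric])
    also have "\<dots> = coeff (lead_coeff L) 0 * (fps_deriv ^^ n) H $ k"
      by (auto simp: fps_mult_nth sum.atLeast_Suc_atMost[of 0] intro!: sum.neutral disjI2 D0)
    finally show "ser.act L H $ k = \<phi> k (H $ (k + n))"
      by (simp add: \<phi>_def fps_deriv_funpow_nth add.commute)
  next
    fix k
    have "coeff (lead_coeff L) 0 * pochhammer (of_nat (Suc k)) n \<noteq> 0"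
      using assms by (simp add: pochhammer_eq_0_iff)
        (metis add.commute add_Suc nat.distinct(1) of_nat_Suc of_nat_add of_nat_eq_0_iff add_eq_0_iff)
    then show "surj (\<phi> k)"
      unfolding \<phi>_def by (intro surjI[where f = "\<lambda>w. w / _"]) (rule nonzero_mult_div_cancel_left | simp)+
  qed (simp add: ser.act_add_right)
  then show ?thesis
    by (simp add: n_def fps_eq_iff)
qed

text \<open>Let t^m be the lowest power of t in the coefficients of R, occurring in the i-th one.
  The solution of L with initial data t^i then gives R u a nonzero coefficient of t^m, since R has
  smaller order than L and sees only the initial data there.\<close>

lemma act_eq_0_imp_eq_0:
  assumes L: "coeff (lead_coeff L) 0 \<noteq> 0"
    and R: "\<And>i. degree L \<le> i \<Longrightarrow> coeff R i = 0"
    and 0: "\<And>u. ser.act L u = 0 \<Longrightarrow> ser.act R u = 0"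
  shows "R = 0"
proof (rule ccontr)
  assume "R \<noteq> 0"
  then have ex: "\<exists>m i. coeff (coeff R i) m \<noteq> 0"
    by (auto simp: poly_eq_iff)
  define m where "m = (LEAST m. \<exists>i. coeff (coeff R i) m \<noteq> 0)"
  from LeastI_ex[OF ex] obtain i where i: "coeff (coeff R i) m \<noteq> 0"
    unfolding m_def by blast
  have min: "coeff (coeff R j) k = 0" if "k < m" for j k
    using not_less_Least[OF that[unfolded m_def]] by blast
  have "i < degree L"
    using i R[of i] by (cases "degree L \<le> i") auto
  obtain u where u: "\<And>j. j < degree L \<Longrightarrow> u $ j = (if j = i then 1 else 0)" "ser.act L u = 0"
    using ode_solution_exists[OF L, of "\<lambda>j. if j = i then 1 else 0"] by blast
  have *: "(fps_of_poly (coeff R j) * (fps_deriv ^^ j) u) $ m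
      = (if j = i then coeff (coeff R i) m * fact i else 0)" for j
  proof -
    have "(fps_of_poly (coeff R j) * (fps_deriv ^^ j) u) $ m
        = (\<Sum>k\<in>{m}. coeff (coeff R j) k * (fps_deriv ^^ j) u $ (m - k))"
      unfolding fps_mult_nth fps_of_poly_nth by (rule sum.mono_neutral_right) (auto simp: min)
    also have "\<dots> = coeff (coeff R j) m * (pochhammer 1 j * u $ j)"
      by (simp add: fps_deriv_funpow_nth)
    also have "\<dots> = (if j = i then coeff (coeff R i) m * fact i else 0)"
      using u(1)[of j] R[of j] \<open>i < degree L\<close> by (cases "j < degree L") (auto simp: pochhammer_fact)
    finally show ?thesis .
  qed
  have "i \<le> degree R"
    using i by (intro le_degree) auto
  then have "ser.act R u $ m = coeff (coeff R i) m * fact i"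
    by (simp add: ser.act_def fps_sum_nth *)
  with i 0[OF u(2)] show False
    by simp
qed

text \<open>The left multiples of L with polynomial coefficients. Multiplication of the type
  \<open>ode\<close> is not the operator product, so they are generated by sums, multiplication by
  functions and left composition with the derivation.\<close>

inductive_set multiples :: "ode \<Rightarrow> ode set" for L :: ode where
  base: "L \<in> multiples L"
| add: "M \<in> multiples L \<Longrightarrow> N \<in> multiples L \<Longrightarrow> M + N \<in> multiples L"
| smult: "M \<in> multiples L \<Longrightarrow> smult q M \<in> multiples L"
| deriv: "M \<in> multiples L \<Longrightarrow> map_poly pderiv M + pCons 0 M \<in> multiples L"

text \<open>Composing L on the left with powers of the derivation raises the order and keeps the
  leading coefficient.\<close>

lemma multiple_of_degree:
  assumes "degree L \<le> n"
  shows "\<exists>M\<in>multiples L. coeff M n = lead_coeff L \<and> (\<forall>i>n. coeff M i = 0)"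
  using assms
proof (induction n rule: dec_induct)
  case base
  then show ?case
    by (intro bexI[of _ L] multiples.base) (simp add: coeff_eq_0)
next
  case (step n)
  then obtain M where M: "M \<in> multiples L" "coeff M n = lead_coeff L" "\<And>i. i > n \<Longrightarrow> coeff M i = 0"
    by blast
  then show ?case
    by (intro bexI[OF _ multiples.deriv[OF M(1)]])
      (auto simp: coeff_map_poly coeff_pCons split: nat.split)
qed

text \<open>Multiplying P by the leading coefficient of L, instead of dividing by it, keeps all
  coefficients polynomial; the factors collect in q.\<close>

lemma pseudo_division:
  assumes "L \<noteq> 0" "\<And>i. n \<le> i \<Longrightarrow> coeff P i = 0"
  shows "\<exists>q R. q \<noteq> 0 \<and> (\<forall>i\<ge>degree L. coeff R i = 0) \<and> smult q P - R \<in> multiples L"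
  using assms(2)
proof (induction n arbitrary: P)
  case (Suc n)
  show ?case
  proof (cases "degree L \<le> n")
    case True
    then obtain M where M: "M \<in> multiples L" "coeff M n = lead_coeff L" "\<And>i. i > n \<Longrightarrow> coeff M i = 0"
      using multiple_of_degree by blast
    define P' where "P' = smult (lead_coeff L) P - smult (coeff P n) M"
    have "coeff P' i = 0" if "n \<le> i" for i
      using that Suc.prems[of i] M(2) M(3)[of i] by (cases "i = n") (auto simp: P'_def)
    from Suc.IH[OF this] obtain q R
      where q: "q \<noteq> 0" "\<forall>i\<ge>degree L. coeff R i = 0" "smult q P' - R \<in> multiples L"
      by blast
    have "smult (q * lead_coeff L) P - R = smult q P' - R + smult (q * coeff P n) M"
      by (simp add: P'_def algebra_simps smult_diff_right)
    also have "\<dots> \<in> multiples L"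
      by (intro multiples.add multiples.smult q M)
    finally show ?thesis
      using q(1,2) \<open>L \<noteq> 0\<close> by (intro exI[of _ "q * lead_coeff L"] exI[of _ R]) auto
  next
    case False
    then show ?thesis
      using Suc.prems multiples.smult[OF multiples.base, of 0 L]
      by (intro exI[of _ 1] exI[of _ P]) auto
  qed
next
  case 0
  then show ?case
    using multiples.smult[OF multiples.base, of 0 L]
    by (intro exI[of _ 1] exI[of _ P]) auto
qed

lemma act_multiple_eq_0:
  assumes "M \<in> multiples L" "ser.act L u = 0"
  shows "ser.act M u = 0"
  using assms proof induction
  case (deriv M)
  then show ?case
    by (simp only: ser.act_deriv_comp) simp
qed (simp_all add: ser.act_add ser.act_smult)

lemma act_multiple_in_left_ideal:
  assumes "M \<in> multiples L"
  shows "rat.act M \<in> left_ideal rat_ops {rat.act L}"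
  using assms
proof induction
  case (add M N)
  have "rat.act (M + N) = (\<lambda>f. rat.act M f + rat.act N f)"
    by (simp add: fun_eq_iff rat.act_add)
  then show ?case
    using left_ideal.add[OF add.IH] by simp
next
  case (smult M q)
  have "rat.act (smult q M) = (\<lambda>f. to_fract q * f) \<circ> rat.act M"
    by (simp add: fun_eq_iff rat.act_smult)
  then show ?case
    using left_ideal.lmult[OF diff_ops.mult smult.IH[unfolded rat_ops_def]] by (simp only: rat_ops_def)
next
  case (deriv M)
  have "rat.act (map_poly pderiv M + pCons 0 M) = rat_deriv \<circ> rat.act M"
    by (simp add: fun_eq_iff rat.act_deriv_comp)
  then show ?case
    using left_ideal.lmult[OF diff_ops.deriv[OF singletonI] deriv.IH[unfolded rat_ops_def]]
    by (simp only: rat_ops_def)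
qed (simp add: left_ideal.gen)

text \<open>The remainder of the pseudo-division also annihilates all solutions of L, hence
  vanishes; the factor q is invertible over the rational functions.\<close>

lemma left_multiple_if_solutions:
  assumes L: "coeff (lead_coeff L) 0 \<noteq> 0"
    and P: "\<And>u. ser.act L u = 0 \<Longrightarrow> ser.act P u = 0"
  shows "rat.act P \<in> left_ideal rat_ops {rat.act L}"
proof -
  have "L \<noteq> 0"
    using L by auto
  then obtain q R where q: "q \<noteq> 0" and R: "\<And>i. degree L \<le> i \<Longrightarrow> coeff R i = 0"
    and M: "smult q P - R \<in> multiples L"
    using pseudo_division[of L "Suc (degree P)" P] by (auto simp: coeff_eq_0)
  have "ser.act R u = 0" if u: "ser.act L u = 0" for u
  proof -
    have "ser.act (smult q P - R) u + ser.act R u = ser.act (smult q P) u"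
      by (simp flip: ser.act_add)
    then show ?thesis
      using P[OF u] act_multiple_eq_0[OF M u] by (simp add: ser.act_smult)
  qed
  from act_eq_0_imp_eq_0[OF L R this] have "R = 0"
    by blast
  with M have "rat.act (smult q P) \<in> left_ideal rat_ops {rat.act L}"
    by (simp add: act_multiple_in_left_ideal)
  then have "(\<lambda>f. inverse (to_fract q) * f) \<circ> rat.act (smult q P) \<in> left_ideal rat_ops {rat.act L}"
    unfolding rat_ops_def by (intro left_ideal.lmult diff_ops.mult)
  also have "(\<lambda>f. inverse (to_fract q) * f) \<circ> rat.act (smult q P) = rat.act P"
    using q by (simp add: fun_eq_iff rat.act_smult flip: mult.assoc)
  finally show ?thesis .
qed

section \<open>Extension of the Weyl algebra to power series\<close>

type_synonym fps2 = "complex fps fps"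

text \<open>Taylor expansion at \<open>(t\<^sub>1, t\<^sub>2) = (0, 1)\<close>; the outer power series variable is \<open>t\<^sub>2 - 1\<close>.\<close>

definition emb :: "poly2 \<Rightarrow> fps2" where
  "emb f = poly (map_poly (\<lambda>p. fps_const (fps_of_poly p)) f) (1 + fps_X)"

lemma emb_0 [simp]: "emb 0 = 0"
  by (simp add: emb_def)

lemma emb_pCons: "emb (pCons p f) = fps_const (fps_of_poly p) + (1 + fps_X) * emb f"
  by (simp add: emb_def map_poly_pCons)

lemma emb_add: "emb (f + g) = emb f + emb g"
  by (induction f g rule: poly_induct2)
    (simp_all add: emb_pCons fps_of_poly_add algebra_simps flip: fps_const_add)

lemma emb_smult: "emb (smult p f) = fps_const (fps_of_poly p) * emb f"
  by (induction f) (simp_all add: emb_pCons fps_of_poly_mult algebra_simps flip: fps_const_mult)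

lemma emb_mult: "emb (f * g) = emb f * emb g"
  by (induction f) (simp_all add: emb_pCons emb_add emb_smult algebra_simps)

lemma emb_1: "emb 1 = 1"
  by (simp add: one_pCons emb_pCons)


definition D1 :: "fps2 \<Rightarrow> fps2" where
  "D1 F = Abs_fps (\<lambda>n. fps_deriv (F $ n))"

definition D2 :: "fps2 \<Rightarrow> fps2" where
  "D2 = fps_deriv"

lemma D1_nth [simp]: "D1 F $ n = fps_deriv (F $ n)"
  by (simp add: D1_def)

lemma D2_nth [simp]: "D2 F $ n = of_nat (Suc n) * F $ Suc n"
  by (simp add: D2_def)

lemma D1_add: "D1 (F + G) = D1 F + D1 G"
  and D1_diff: "D1 (F - G) = D1 F - D1 G"
  and D1_minus: "D1 (- F) = - D1 F"
  and D2_add: "D2 (F + G) = D2 F + D2 G"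
  and D2_diff: "D2 (F - G) = D2 F - D2 G"
  and D2_minus: "D2 (- F) = - D2 F"
  by (simp_all add: fps_eq_iff algebra_simps)

lemma D1_mult: "D1 (F * G) = D1 F * G + F * D1 G"
  by (rule fps_ext)
    (simp add: fps_mult_nth ser.D_sum fps_deriv_mult sum.distrib add.commute)

lemma D2_mult: "D2 (F * G) = D2 F * G + F * D2 G"
  by (simp add: D2_def)

lemma D1_D2: "D1 (D2 F) = D2 (D1 F)"
  by (simp add: fps_eq_iff)

lemma emb_d1: "emb (d1 f) = D1 (emb f)"
proof (induction f)
  case (pCons p f)
  have "D1 (fps_const g) = fps_const (fps_deriv g)" "D1 (1 + fps_X) = 0" for g
    by (simp_all add: fps_eq_iff fps_X_def)
  then show ?case
    by (simp add: emb_pCons pCons.IH D1_add D1_mult fps_of_poly_pderiv)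
qed (simp add: fps_eq_iff)

lemma emb_d2: "emb (d2 f) = D2 (emb f)"
  by (induction f)
    (simp_all add: D2_def d2_def emb_pCons emb_add pderiv_pCons algebra_simps)

section \<open>Continuous extension of operators from polynomials to power series\<close>

definition eq_upto :: "nat \<Rightarrow> fps2 \<Rightarrow> fps2 \<Rightarrow> bool" where
  "eq_upto n F G \<longleftrightarrow> (\<forall>j<n. \<forall>i<n. F $ j $ i = G $ j $ i)"

lemma eq_upto_mono: "eq_upto n F G \<Longrightarrow> m \<le> n \<Longrightarrow> eq_upto m F G"
  by (auto simp: eq_upto_def)

lemma eq_upto_mult: "eq_upto n F G \<Longrightarrow> eq_upto n (H * F) (H * G)"
  by (auto simp: eq_upto_def fps_mult_nth fps_sum_nth intro!: sum.cong)

text \<open>\<open>eq_upto n\<close> is congruence modulo the ideal (t1^n, s^n). Truncating F in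
  both variables gives a polynomial in t1 and t2 - 1.\<close>

lemma emb_dense: "\<exists>f. eq_upto n F (emb f)"
proof -
  define p where "p j = (\<Sum>i<n. monom (F $ j $ i) i)" for j
  define f where "f = (\<Sum>j<n. smult (p j) ([:- 1, 1:] ^ j))"
  have sum: "emb (\<Sum>j\<in>J. g j) = (\<Sum>j\<in>J. emb (g j))" for J :: "nat set" and g
    by (induction J rule: infinite_finite_induct) (simp_all add: emb_add)
  have "emb [:- 1, 1:] = fps_X"
    by (simp add: emb_pCons emb_1 ser.h_minus flip: fps_const_neg)
  then have "emb ([:- 1, 1:] ^ j) = fps_X ^ j" for j
    by (induction j) (simp_all add: emb_1 emb_mult del: mult_pCons_left)
  then have "emb f = (\<Sum>j<n. fps_const (fps_of_poly (p j)) * fps_X ^ j)"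
    by (simp add: f_def sum emb_smult)
  moreover have "F $ j $ i = (\<Sum>j'<n. fps_const (fps_of_poly (p j')) * fps_X ^ j') $ j $ i"
    if "j < n" "i < n" for i j
    using that by (simp add: fps_sum_nth if_distrib[of "\<lambda>x. _ * x"] p_def coeff_sum cong: if_cong)
  ultimately have "eq_upto n F (emb f)"
    by (simp add: eq_upto_def)
  then show ?thesis ..
qed

text \<open>
  Since polynomials are dense, the continuity condition makes the extension of an operator unique;
  so an identity between operators on polynomials carries over to power series.
\<close>

definition extends :: "(poly2 \<Rightarrow> poly2) \<Rightarrow> (fps2 \<Rightarrow> fps2) \<Rightarrow> bool" where
  "extends A A' \<longleftrightarrow> (\<forall>f. A' (emb f) = emb (A f)) \<and>
     (\<exists>m. \<forall>n F G. eq_upto (n + m) F G \<longrightarrow> eq_upto n (A' F) (A' G))"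

lemma extends_unique:
  assumes "extends A A'" "extends A A''"
  shows "A' = A''"
proof
  fix F
  obtain m m' where
    m: "\<And>n F G. eq_upto (n + m) F G \<Longrightarrow> eq_upto n (A' F) (A' G)" and
    m': "\<And>n F G. eq_upto (n + m') F G \<Longrightarrow> eq_upto n (A'' F) (A'' G)"
    using assms by (auto simp: extends_def)
  have "A' F $ j $ i = A'' F $ j $ i" for i j
  proof -
    define n where "n = Suc (max i j)"
    obtain f where f: "eq_upto (n + m + m') F (emb f)"
      using emb_dense by blast
    have "eq_upto n (A' F) (emb (A f))" "eq_upto n (A'' F) (emb (A f))"
      using m[OF eq_upto_mono[OF f, of "n + m"]] m'[OF eq_upto_mono[OF f, of "n + m'"]] assms
      by (simp_all add: extends_def)
    then show ?thesis
      by (simp add: eq_upto_def n_def)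
  qed
  then show "A' F = A'' F"
    by (simp add: fps_eq_iff)
qed

lemma extends_id: "extends (\<lambda>f. f) (\<lambda>F. F)"
  by (auto simp: extends_def intro: exI[of _ 0])

lemma extends_add:
  assumes "extends A A'" "extends B B'"
  shows "extends (\<lambda>f. A f + B f) (\<lambda>F. A' F + B' F)"
proof -
  obtain m m' where
    m: "\<And>n F G. eq_upto (n + m) F G \<Longrightarrow> eq_upto n (A' F) (A' G)" and
    m': "\<And>n F G. eq_upto (n + m') F G \<Longrightarrow> eq_upto n (B' F) (B' G)"
    using assms by (auto simp: extends_def)
  have "eq_upto n (A' F + B' F) (A' G + B' G)" if "eq_upto (n + (m + m')) F G" for n F G
    using m[OF eq_upto_mono[OF that, of "n + m"]] m'[OF eq_upto_mono[OF that, of "n + m'"]]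
    by (simp add: eq_upto_def)
  then show ?thesis
    using assms by (auto simp: extends_def emb_add)
qed

lemma extends_comp:
  assumes "extends A A'" "extends B B'"
  shows "extends (A \<circ> B) (A' \<circ> B')"
proof -
  obtain m m' where
    m: "\<And>n F G. eq_upto (n + m) F G \<Longrightarrow> eq_upto n (A' F) (A' G)" and
    m': "\<And>n F G. eq_upto (n + m') F G \<Longrightarrow> eq_upto n (B' F) (B' G)"
    using assms by (auto simp: extends_def)
  have "eq_upto n (A' (B' F)) (A' (B' G))" if "eq_upto (n + (m + m')) F G" for n F G
    using m[OF m'] that by (simp add: add.assoc)
  then show ?thesis
    using assms by (auto simp: extends_def)
qed

lemma extends_mult: "extends (\<lambda>f. g * f) (\<lambda>F. emb g * F)"
  by (auto simp: extends_def emb_mult eq_upto_mult intro: exI[of _ 0])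

lemma extends_d1: "extends d1 D1"
  by (auto simp: extends_def emb_d1 eq_upto_def intro!: exI[of _ 1])

lemma extends_d2: "extends d2 D2"
proof -
  have "eq_upto n (D2 F) (D2 G)" if "eq_upto (n + 1) F G" for n F G
  proof -
    have "(of_nat (Suc j) * F $ Suc j) $ i = of_nat (Suc j) * F $ Suc j $ i" for F :: fps2 and i j
      by (metis fps_mult_left_const_nth fps_of_nat)
    then show ?thesis
      using that by (simp add: eq_upto_def del: of_nat_Suc)
  qed
  then show ?thesis
    by (auto simp: extends_def emb_d2 intro!: exI[of _ 1])
qed

lemma weyl2_extends:
  assumes "A \<in> weyl2"
  shows "\<exists>A'. extends A A'"
  using assms unfolding weyl2_def
proof induction
  case (deriv D)
  then show ?case
    using extends_d1 extends_d2 by auto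
qed (blast intro: extends_mult extends_add extends_comp)+

lemma weyl2_0:
  assumes "A \<in> weyl2"
  shows "A 0 = 0"
  using assms unfolding weyl2_def
  by induction (auto simp: d2_def)

lemma left_ideal_extends:
  assumes "C \<in> left_ideal weyl2 S"
    and S: "\<And>A. A \<in> S \<Longrightarrow> \<exists>A'. extends A A' \<and> A' F = 0"
  shows "\<exists>C'. extends C C' \<and> C' F = 0"
  using assms(1)
proof induction
  case zero
  show ?case
    by (intro exI[of _ "\<lambda>_. 0"]) (simp add: extends_def eq_upto_def)
next
  case (gen A)
  then show ?case
    by (rule S)
next
  case (add A B)
  then show ?case
    using extends_add by fastforce
next
  case (lmult A B)
  then obtain A' B' where A': "extends A A'" and B': "extends B B'" "B' F = 0"
    using weyl2_extends by blast
  \<comment> \<open>The extension maps 0 = emb 0 to emb (A 0) = 0.\<close>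
  have "(A' \<circ> B') F = 0"
    using A' B'(2) weyl2_0[OF lmult.hyps(1)] by (metis emb_0 extends_def o_apply)
  then show ?case
    using extends_comp[OF A' B'(1)] by blast
qed

lemma extends_funpow: "extends A A' \<Longrightarrow> extends (A ^^ i) (A' ^^ i)"
proof (induction i)
  case 0
  then show ?case
    using extends_id by (simp add: id_def)
next
  case (Suc i)
  then show ?case
    unfolding funpow.simps by (blast intro: extends_comp)
qed

lemma extends_sum:
  "finite I \<Longrightarrow> (\<And>i. i \<in> I \<Longrightarrow> extends (A i) (A' i)) \<Longrightarrow>
     extends (\<lambda>f. \<Sum>i\<in>I. A i f) (\<lambda>F. \<Sum>i\<in>I. A' i F)"
proof (induction rule: finite_induct)
  case empty
  show ?case
    by (simp add: extends_def eq_upto_def)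
next
  case (insert i I)
  then show ?case
    by (simp add: extends_add)
qed

text \<open>P contains neither t2 nor its derivation, so its extension acts on each coefficient of s
  separately.\<close>

lemma extends_op_t1:
  "\<exists>A'. extends (op_t1 P) A' \<and> (\<forall>F. A' F $ 0 = ser.act P (F $ 0))"
proof (intro exI conjI allI)
  define A' where "A' i = (\<lambda>F. emb [:coeff P i:] * F) \<circ> D1 ^^ i" for i
  show "extends (op_t1 P) (\<lambda>F. \<Sum>i\<le>degree P. A' i F)"
    unfolding op_t1_def A'_def
    using extends_sum[OF _ extends_comp[OF extends_mult extends_funpow[OF extends_d1]],
      of "{..degree P}" "\<lambda>i. [:coeff P i:]" "\<lambda>i. i"]
    by (simp add: o_def)
  have "(D1 ^^ i) F $ 0 = (fps_deriv ^^ i) (F $ 0)" for i F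
    by (induction i) simp_all
  then show "(\<Sum>i\<le>degree P. A' i F) $ 0 = ser.act P (F $ 0)" for F
    by (simp add: A'_def fps_sum_nth ser.act_def emb_pCons)
qed

text \<open>Membership in the left ideal gives an extension of P + (t2 - 1) Q that annihilates F. By
  uniqueness it is the sum of the extensions of P and (t2 - 1) Q, and at s = 0 the second summand
  disappears.\<close>

lemma restriction_annihilates:
  assumes P: "P \<in> restriction a0 a1 a2 a3"
    and "extends (P1 a0 a1 a2 a3) A" "A F = 0" "extends (P2 a0 a1 a2 a3) B" "B F = 0"
  shows "ser.act P (F $ 0) = 0"
proof -
  obtain Q where Q: "Q \<in> weyl2" and C: "(\<lambda>f. op_t1 P f + (t2 - 1) * Q f) \<in> Z2 a0 a1 a2 a3"
    using P by (auto simp: restriction_def)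
  obtain C' where C': "extends (\<lambda>f. op_t1 P f + (t2 - 1) * Q f) C'" "C' F = 0"
    using left_ideal_extends[OF C[unfolded Z2_def], of F] assms(2-) by auto
  obtain Q' where Q': "extends Q Q'"
    using weyl2_extends[OF Q] by blast
  obtain P' where P': "extends (op_t1 P) P'" "\<And>F. P' F $ 0 = ser.act P (F $ 0)"
    using extends_op_t1 by blast
  have "emb (t2 - 1) = fps_X"
    by (simp add: t2_def one_pCons emb_pCons)
  then have "extends (\<lambda>f. op_t1 P f + (t2 - 1) * Q f) (\<lambda>F. P' F + fps_X * Q' F)"
    using extends_add[OF P'(1) extends_comp[OF extends_mult Q'], of "t2 - 1"] by (simp add: o_def)
  from extends_unique[OF this C'(1)] C'(2) have "P' F + fps_X * Q' F = 0"
    by metis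
  then have "(P' F + fps_X * Q' F) $ 0 = 0"
    by simp
  then show ?thesis
    by (simp add: P'(2))
qed

section \<open>The two operators on power series\<close>

definition X :: fps2 where "X = fps_const ser.x"
definition Y :: fps2 where "Y = 1 + fps_X"
definition K :: "complex \<Rightarrow> fps2" where "K a = fps_const (ser.c a)"

lemma emb_t1: "emb t1 = X" and emb_t2: "emb t2 = Y" and emb_cst: "emb (cst a) = K a"
  by (simp_all add: t1_def t2_def cst_def X_def Y_def K_def emb_pCons emb_1 one_pCons[symmetric] ser.x_def ser.c_def)

definition P1_fps :: "complex \<Rightarrow> complex \<Rightarrow> fps2 \<Rightarrow> fps2" where
  "P1_fps a0 a3 F =
     (1 - X^2) * D1 (D1 F) + 2 * (1 - X * Y) * D1 (D2 F) + (1 - Y^2) * D2 (D2 F)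
     + K a0 * (X * D1 F + Y * D2 F) + K a3 * F"

definition P2_fps :: "complex \<Rightarrow> complex \<Rightarrow> complex \<Rightarrow> fps2 \<Rightarrow> fps2" where
  "P2_fps a0 a1 a2 F =
     2 * (X - Y) *
       ((1 - Y^2) * D1 (D2 (D2 F)) + K a0 * Y * D1 (D2 F) + K a1 * D1 F
        + (1 - X^2) * D1 (D1 (D2 F)) + K a0 * X * D1 (D2 F) + K a2 * D2 F)
     - (2 + K a0) *
       ((1 - Y^2) * D2 (D2 F) + K a0 * Y * D2 F + K a1 * F
        - (1 - X^2) * D1 (D1 F) - K a0 * X * D1 F - K a2 * F)"

lemma emb_diff: "emb (f - g) = emb f - emb g"
  using emb_add[of "f - g" g] by (simp add: eq_diff_eq)

lemma emb_power: "emb (f ^ n) = emb f ^ n"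
  by (induction n) (simp_all add: emb_1 emb_mult)

lemma emb_2: "emb 2 = 2"
  using emb_add[of 1 1] by (simp add: emb_1)

lemma K_2_add: "K (2 + a) = 2 + K a"
  by (simp add: K_def fps_numeral_fps_const flip: fps_const_add)

lemma extends_diff: "extends A A' \<Longrightarrow> extends B B' \<Longrightarrow> extends (\<lambda>f. A f - B f) (\<lambda>F. A' F - B' F)"
  using extends_add[of A A' "\<lambda>f. - 1 * B f" "\<lambda>F. emb (- 1) * B' F"]
    extends_comp[OF extends_mult, of B B' "- 1"] emb_diff[of 0 1]
  by (simp add: o_def emb_1)

lemma extends_intros:
  assumes "extends A A'"
  shows "extends (\<lambda>f. g * A f) (\<lambda>F. emb g * A' F)"
    and "extends (\<lambda>f. d1 (A f)) (\<lambda>F. D1 (A' F))"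
    and "extends (\<lambda>f. d2 (A f)) (\<lambda>F. D2 (A' F))"
  using extends_comp[OF _ assms] extends_mult extends_d1 extends_d2 by (auto simp: o_def)

lemma extends_P1: "extends (P1 a0 a1 a2 a3) (P1_fps a0 a3)"
proof -
  have "extends (P1 a0 a1 a2 a3) (\<lambda>F. emb (1 - t1^2) * D1 (D1 F)
      + emb (2 * (1 - t1 * t2)) * D1 (D2 F) + emb (1 - t2^2) * D2 (D2 F)
      + emb (cst a0) * (emb t1 * D1 F + emb t2 * D2 F) + emb (cst a3) * F)"
    unfolding P1_def[abs_def]
    by (intro extends_add extends_intros extends_id)
  then show ?thesis
    by (simp add: P1_fps_def[abs_def] emb_diff emb_mult emb_power emb_1 emb_2 emb_t1 emb_t2 emb_cst)
qed

lemma extends_P2: "extends (P2 a0 a1 a2 a3) (P2_fps a0 a1 a2)"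
proof -
  have "extends (P2 a0 a1 a2 a3) (\<lambda>F. emb (2 * (t1 - t2)) *
       (emb (1 - t2^2) * D1 (D2 (D2 F)) + emb (cst a0 * t2) * D1 (D2 F) + emb (cst a1) * D1 F
        + emb (1 - t1^2) * D1 (D1 (D2 F)) + emb (cst a0 * t1) * D1 (D2 F) + emb (cst a2) * D2 F)
     - emb (cst (2 + a0)) *
       (emb (1 - t2^2) * D2 (D2 F) + emb (cst a0 * t2) * D2 F + emb (cst a1) * F
        - emb (1 - t1^2) * D1 (D1 F) - emb (cst a0 * t1) * D1 F - emb (cst a2) * F))"
    unfolding P2_def[abs_def]
    by (intro extends_add extends_diff extends_intros extends_id)
  then show ?thesis
    by (simp add: P2_fps_def[abs_def] emb_diff emb_mult emb_power emb_1 emb_2 K_2_add emb_t1 emb_t2 emb_cst)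
qed

lemma D1_fps_const: "D1 (fps_const f) = fps_const (fps_deriv f)"
  by (rule fps_ext) simp

lemma D1_rules [simp]: "D1 X = 1" "D1 Y = 0" "D1 (K a) = 0" "D1 1 = 0" "D1 (numeral n) = 0"
proof -
  show "D1 1 = 0"
    using D1_fps_const[of 1] by simp
  then show "D1 Y = 0"
    by (simp add: Y_def D1_add) (simp add: fps_eq_iff fps_X_nth)
qed (simp_all add: X_def K_def D1_fps_const fps_numeral_fps_const)

lemma D2_rules [simp]: "D2 X = 0" "D2 Y = 1" "D2 (K a) = 0" "D2 1 = 0" "D2 (numeral n) = 0"
  by (simp_all add: D2_def X_def Y_def K_def)

lemma D1_square: "D1 (F\<^sup>2) = 2 * F * D1 F" and D2_square: "D2 (F\<^sup>2) = 2 * F * D2 F"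
  by (simp_all add: power2_eq_square D1_mult D2_mult algebra_simps)

text \<open>The compatibility condition of the overdetermined system; it propagates the vanishing of
  P1 F and P2 F from one power of s to the next.\<close>

lemma P1_fps_P2_fps: "P1_fps a0 a3 (P2_fps a0 a1 a2 F) = P2_fps a0 a1 a2 (P1_fps a0 a3 F)"
  unfolding P1_fps_def P2_fps_def
  by (simp add: D1_add D1_diff D1_minus D2_minus D2_add D2_diff D1_mult D2_mult D1_square D2_square D1_D2) algebra

lemma one_minus_X_square: "1 - X\<^sup>2 = fps_const (1 - ser.x\<^sup>2)"
  by (simp add: X_def flip: fps_const_sub)

text \<open>The factor s keeps second derivatives in t2 from bringing the coefficient k + 2 of F
  into the k-th equation.\<close>

lemma one_minus_Y_square: "1 - Y\<^sup>2 = - (fps_X * (2 + fps_X))"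
  by (simp add: Y_def power2_eq_square algebra_simps)

lemma two_fps: "2 = (fps_const 2 :: fps2)"
  by (simp add: fps_numeral_fps_const)

lemma P1_fps_nth:
  "P1_fps a0 a3 F $ k = (1 - ser.x\<^sup>2) * fps_deriv (fps_deriv (F $ k))
     + 2 * (1 - ser.x) * of_nat (Suc k) * fps_deriv (F $ Suc k) - 2 * ser.x * of_nat k * fps_deriv (F $ k)
     - 2 * of_nat k * of_nat (Suc k) * F $ Suc k - of_nat k * (of_nat k - 1) * F $ k
     + ser.c a0 * (ser.x * fps_deriv (F $ k) + of_nat (Suc k) * F $ Suc k + of_nat k * F $ k)
     + ser.c a3 * F $ k"
proof -
  have "P1_fps a0 a3 F = fps_const (1 - ser.x\<^sup>2) * D1 (D1 F) + fps_const (2 * (1 - ser.x)) * D1 (D2 F)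
      - fps_X * (fps_const (2 * ser.x) * D1 (D2 F) + fps_const 2 * D2 (D2 F) + fps_X * D2 (D2 F))
      + fps_const (ser.c a0) * (fps_const ser.x * D1 F + D2 F + fps_X * D2 F) + fps_const (ser.c a3) * F"
    unfolding P1_fps_def one_minus_X_square one_minus_Y_square two_fps
    unfolding X_def Y_def K_def
    unfolding fps_const_mult[symmetric] fps_const_sub[symmetric] fps_const_1_eq_1
    by algebra
  then show ?thesis
    by (cases k; cases "k - 1"; simp; (algebra | simp add: algebra_simps))
qed

lemma P2_fps_nth:
  fixes F k a0 a1 a2
  defines "W \<equiv> \<lambda>k. - 2 * of_nat k * of_nat (Suc k) * fps_deriv (F $ Suc k)
       - of_nat k * (of_nat k - 1) * fps_deriv (F $ k)
       + ser.c a0 * (of_nat (Suc k) * fps_deriv (F $ Suc k) + of_nat k * fps_deriv (F $ k))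
       + ser.c a1 * fps_deriv (F $ k)
       + (1 - ser.x\<^sup>2) * of_nat (Suc k) * fps_deriv (fps_deriv (F $ Suc k))
       + ser.c a0 * ser.x * of_nat (Suc k) * fps_deriv (F $ Suc k)
       + ser.c a2 * of_nat (Suc k) * F $ Suc k"
  shows "P2_fps a0 a1 a2 F $ k = 2 * (ser.x - 1) * W k - (if k = 0 then 0 else 2 * W (k - 1))
     - (2 + ser.c a0) *
       (- 2 * of_nat k * of_nat (Suc k) * F $ Suc k - of_nat k * (of_nat k - 1) * F $ k
        + ser.c a0 * (of_nat (Suc k) * F $ Suc k + of_nat k * F $ k) + ser.c a1 * F $ k
        - (1 - ser.x\<^sup>2) * fps_deriv (fps_deriv (F $ k)) - ser.c a0 * ser.x * fps_deriv (F $ k)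
        - ser.c a2 * F $ k)"
proof -
  \<comment> \<open>G and V are the two braces of P2. The factor 2 (t1 - t2) = 2 (t1 - 1) - 2 s
    produces W k and the shifted W (k - 1), which is absent for k = 0.\<close>
  define G where "G = - (fps_X * (fps_const 2 * D1 (D2 (D2 F)) + fps_X * D1 (D2 (D2 F))))
     + fps_const (ser.c a0) * (D1 (D2 F) + fps_X * D1 (D2 F)) + fps_const (ser.c a1) * D1 F
     + fps_const (1 - ser.x\<^sup>2) * D1 (D1 (D2 F)) + fps_const (ser.c a0 * ser.x) * D1 (D2 F)
     + fps_const (ser.c a2) * D2 F"
  define V where "V = - (fps_X * (fps_const 2 * D2 (D2 F) + fps_X * D2 (D2 F)))
     + fps_const (ser.c a0) * (D2 F + fps_X * D2 F) + fps_const (ser.c a1) * F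
     - fps_const (1 - ser.x\<^sup>2) * D1 (D1 F) - fps_const (ser.c a0 * ser.x) * D1 F
     - fps_const (ser.c a2) * F"
  have "P2_fps a0 a1 a2 F = fps_const (2 * (ser.x - 1)) * G - fps_const 2 * (fps_X * G)
      - fps_const (2 + ser.c a0) * V"
    unfolding P2_fps_def one_minus_X_square one_minus_Y_square two_fps G_def V_def
    unfolding X_def Y_def K_def
    unfolding fps_const_mult[symmetric] fps_const_sub[symmetric] fps_const_add[symmetric] fps_const_1_eq_1
    by algebra
  moreover have "G $ k = W k" for k
    unfolding G_def W_def
    by (cases k; cases "k - 1"; simp; (algebra | simp add: algebra_simps))
  moreover have "V $ k = - 2 * of_nat k * of_nat (Suc k) * F $ Suc k - of_nat k * (of_nat k - 1) * F $ k
        + ser.c a0 * (of_nat (Suc k) * F $ Suc k + of_nat k * F $ k) + ser.c a1 * F $ k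
        - (1 - ser.x\<^sup>2) * fps_deriv (fps_deriv (F $ k)) - ser.c a0 * ser.x * fps_deriv (F $ k)
        - ser.c a2 * F $ k"
    unfolding V_def
    by (cases k; cases "k - 1"; simp; (algebra | simp add: algebra_simps))
  ultimately show ?thesis
    by (simp only: fps_sub_nth fps_mult_left_const_nth fps_X_mult_nth) simp
qed

lemma P1_fps_lead:
  assumes "\<And>j. j \<le> k \<Longrightarrow> H $ j = 0"
  shows "P1_fps a0 a3 H $ k = of_nat (Suc k) * ser.lead1 a0 k (H $ Suc k)"
  using assms[of k] by (simp add: P1_fps_nth ser.lead1_def algebra_simps)

lemma P2_fps_lead:
  assumes "\<And>j. j \<le> k \<Longrightarrow> H $ j = 0"
  shows "P2_fps a0 a1 a2 H $ k = of_nat (Suc k) * ser.lead2 a0 a2 k (H $ Suc k)"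
  using assms[of k] assms[of "k - 1"] unfolding P2_fps_nth ser.lead2_def
  by (cases k; simp; (algebra | simp add: algebra_simps))

lemma P1_fps_add: "P1_fps a0 a3 (F + G) = P1_fps a0 a3 F + P1_fps a0 a3 G"
  by (simp add: P1_fps_def D1_add D2_add algebra_simps)

lemma P2_fps_add: "P2_fps a0 a1 a2 (F + G) = P2_fps a0 a1 a2 F + P2_fps a0 a1 a2 G"
  by (simp add: P2_fps_def D1_add D2_add algebra_simps)

lemma ser_x: "ser.x = fps_X" and ser_c: "ser.c a = fps_const a"
  by (simp_all add: ser.x_def ser.c_def fps_of_poly_pCons)

lemma x_minus_1_nonzero: "ser.x - 1 \<noteq> 0"
  by (simp add: ser_x fps_eq_iff) (metis fps_X_nth)

section \<open>The restriction\<close>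

lemma fps_solution_exists:
  assumes kappa: "\<And>k. kappa a0 a2 k \<noteq> 0"
    and u: "ser.act (Z a0 a1 a2 a3) u = 0"
  shows "\<exists>F. F $ 0 = u \<and> P1_fps a0 a3 F = 0 \<and> P2_fps a0 a1 a2 F = 0"
proof -
  \<comment> \<open>In this combination the unknown coefficient k + 1 of F appears without
    derivatives, with factor w k.\<close>
  define T where "T F k = 2 * P2_fps a0 a1 a2 F $ k + ser.cofactor a0 k (P1_fps a0 a3 F $ k)" for F k
  define w where "w k = of_nat (Suc k) * (ser.c (kappa a0 a2 k) * (ser.x - 1))" for k
  have cofactor_add: "ser.cofactor a0 k (v + v') = ser.cofactor a0 k v + ser.cofactor a0 k v'" for k v v'
    by (simp add: ser.cofactor_def algebra_simps)
  have cofactor_of_nat: "ser.cofactor a0 k (of_nat m * v) = of_nat m * ser.cofactor a0 k v" for k m v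
    by (simp add: ser.cofactor_def algebra_simps)
  have "\<exists>F. (\<forall>j<1. F $ j = u) \<and> (\<forall>k. T F k = 0)"
  proof (rule graded_solution_exists[where \<phi> = "\<lambda>k v. w k * v"])
    show "T (F + G) k = T F k + T G k" for F G k
      by (simp add: T_def P1_fps_add P2_fps_add cofactor_add algebra_simps)
  next
    fix H :: fps2 and k
    assume "\<And>j. j < k + 1 \<Longrightarrow> H $ j = 0"
    then have H: "\<And>j. j \<le> k \<Longrightarrow> H $ j = 0"
      by simp
    show "T H k = w k * H $ (k + 1)"
      using ser.lead2_plus_cofactor_lead1[of a0 a2 k "H $ Suc k"]
      by (simp add: T_def w_def P1_fps_lead[OF H] P2_fps_lead[OF H] cofactor_of_nat algebra_simps
          del: of_nat_Suc flip: distrib_left)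
  next
    fix k
    \<comment> \<open>The constant term of w k is - (k + 1) kappa_k, so w k is a unit among the
      power series in t.\<close>
    have "(of_nat (Suc k) :: complex fps) $ 0 \<noteq> 0"
      by (metis fps_of_nat fps_nth_fps_const of_nat_eq_0_iff nat.distinct(1))
    then have "w k $ 0 \<noteq> 0"
      using kappa[of k] by (simp add: w_def ser_x ser_c del: of_nat_Suc)
    then have "w k * (inverse (w k) * v) = v" for v
      by (simp add: inverse_mult_eq_1' flip: mult.assoc)
    then show "surj (\<lambda>v. w k * v)"
      by (intro surjI[where f = "\<lambda>v. inverse (w k) * v"])
  qed
  then obtain F where F0: "F $ 0 = u" and T: "\<And>k. T F k = 0"
    by auto
  define e where "e k = P1_fps a0 a3 F $ k" for k
  \<comment> \<open>So far only the combination 2 g + cofactor e vanishes. It determines g from e,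
    so it remains to show e = 0.\<close>
  define g where "g k = P2_fps a0 a1 a2 F $ k" for k
  have 2: "2 * g k = - ser.cofactor a0 k (e k)" for k
    using T[of k] by (simp add: T_def e_def g_def eq_neg_iff_add_eq_0)
  have g_eq_0: "g k = 0" if "e k = 0" for k
    using 2[of k] that by (simp add: ser.cofactor_def)
  have cancel: "e k = 0" if "ser.c (kappa a0 a2 k) * (ser.x - 1) * e k = 0" for k
    using that x_minus_1_nonzero kappa[of k] by (simp add: ser_c)
  have "e k = 0 \<and> g k = 0" for k
  proof (induction k rule: less_induct)
    case (less k)
    have "e k = 0"
    proof (cases k)
      case 0
      \<comment> \<open>F $ 1 is the restricted t2-derivative v of \<open>two_act_Z\<close>. As the
        combination vanishes and Z(a) u = 0, only the term kappa_0 (x - 1) e 0 is left.\<close>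
      have "e 0 = ser.restr1 a0 a3 u (F $ 1)" "g 0 = ser.restr2 a0 a1 a2 u (F $ 1)"
        by (simp_all add: e_def g_def P1_fps_nth P2_fps_nth ser.restr1_def ser.restr2_def ser.lead1_def ser.lead2_def
            F0 algebra_simps)
      then have "2 * ser.act (Z a0 a1 a2 a3) u = ser.c (kappa a0 a2 0) * (ser.x - 1) * e 0
          - (ser.lead1 a0 0 (2 * g 0 + ser.cofactor a0 0 (e 0)) + 2 * (2 * g 0 + ser.cofactor a0 0 (e 0)))"
        by (simp only: ser.two_act_Z[of a0 a1 a2 a3 u "F $ 1"])
      moreover have "2 * g 0 + ser.cofactor a0 0 (e 0) = 0"
        by (simp add: 2)
      ultimately have "ser.c (kappa a0 a2 0) * (ser.x - 1) * e 0 = 0"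
        using u by (simp only: ser.lead1_def) simp
      with 0 cancel show ?thesis
        by simp
    next
      case (Suc m)
      \<comment> \<open>By induction P1 F and P2 F vanish below s^k, so the lowest term formulas
        apply to them at m = k - 1, and commutation relates e k to g k.\<close>
      have "P1_fps a0 a3 (P2_fps a0 a1 a2 F) $ m = of_nat (Suc m) * ser.lead1 a0 m (g k)"
        using less Suc by (subst P1_fps_lead) (auto simp: g_def)
      moreover have "P2_fps a0 a1 a2 (P1_fps a0 a3 F) $ m = of_nat (Suc m) * ser.lead2 a0 a2 m (e k)"
        using less Suc by (subst P2_fps_lead) (auto simp: e_def)
      ultimately have "ser.lead1 a0 m (g k) = ser.lead2 a0 a2 m (e k)"
        by (simp add: P1_fps_P2_fps del: of_nat_Suc)
      then have "2 * ser.lead2 a0 a2 m (e k) = 2 * ser.lead1 a0 m (g k)"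
        by simp
      also have "\<dots> = ser.lead1 a0 m (2 * g k)"
        by (simp add: ser.lead1_def algebra_simps)
      also have "\<dots> = - ser.lead1 a0 m (ser.cofactor a0 (Suc m) (e k))"
        unfolding 2 Suc by (simp add: ser.lead1_def algebra_simps)
      finally have "ser.c (kappa a0 a2 k) * (ser.x - 1) * e k = 0"
        using ser.lead2_plus_lead1_cofactor[of a0 a2 m "e k"] Suc by simp
      then show ?thesis
        by (rule cancel)
    qed
    then show ?case
      by (simp add: g_eq_0)
  qed
  then have "P1_fps a0 a3 F = 0" "P2_fps a0 a1 a2 F = 0"
    by (simp_all add: fps_eq_iff e_def g_def)
  with F0 show ?thesis
    by blast
qed

section \<open>Membership of Z(a) in the restriction\<close>

lemma pol_x: "pol.x = t1" and pol_c: "pol.c a = cst a"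
  by (simp_all add: pol.x_def pol.c_def t1_def cst_def)

lemma weyl2_intros:
  "(\<lambda>f. f) \<in> weyl2"
  "A \<in> weyl2 \<Longrightarrow> (\<lambda>f. p * A f) \<in> weyl2"
  "A \<in> weyl2 \<Longrightarrow> (\<lambda>f. d1 (A f)) \<in> weyl2"
  "A \<in> weyl2 \<Longrightarrow> (\<lambda>f. d2 (A f)) \<in> weyl2"
  "A \<in> weyl2 \<Longrightarrow> B \<in> weyl2 \<Longrightarrow> (\<lambda>f. A f + B f) \<in> weyl2"
  "A \<in> weyl2 \<Longrightarrow> B \<in> weyl2 \<Longrightarrow> (\<lambda>f. A f - B f) \<in> weyl2"
proof -
  have "(\<lambda>f. 1 * f) \<in> weyl2"
    unfolding weyl2_def by (rule diff_ops.mult)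
  then show "(\<lambda>f. f) \<in> weyl2"
    by (simp only: mult_1)
  show m: "(\<lambda>f. p * A f) \<in> weyl2" if "A \<in> weyl2" for p A
    using diff_ops.comp[OF diff_ops.mult that[unfolded weyl2_def]] by (simp add: weyl2_def o_def)
  show "(\<lambda>f. d1 (A f)) \<in> weyl2" "(\<lambda>f. d2 (A f)) \<in> weyl2" if "A \<in> weyl2" for A
    using diff_ops.comp[OF diff_ops.deriv that[unfolded weyl2_def]] by (simp_all add: weyl2_def o_def)
  show a: "(\<lambda>f. A f + B f) \<in> weyl2" if "A \<in> weyl2" "B \<in> weyl2" for A B
    using diff_ops.add that by (simp add: weyl2_def)
  show "(\<lambda>f. A f - B f) \<in> weyl2" if "A \<in> weyl2" "B \<in> weyl2" for A B
    using a[OF that(1) m[OF that(2), of "- 1"]] by simp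
qed

lemma Z_in_restriction: "Z a0 a1 a2 a3 \<in> restriction a0 a1 a2 a3"
proof -
  define s where "s = t2 - 1"
  define h where "h = cst (1 / 2)"
  \<comment> \<open>A and B collect the terms in e = restr1 and g = restr2 on the right of
    \<open>two_act_Z\<close>, halved.\<close>
  define A where "A e = h * (pol.c (kappa a0 a2 0) * (pol.x - 1) * e
    - (pol.lead1 a0 0 (pol.cofactor a0 0 e) + 2 * pol.cofactor a0 0 e))" for e
  define B where "B g = h * (- 2 * pol.lead1 a0 0 g - 4 * g)" for g
  \<comment> \<open>R1 and R2 are the quotients by s of the differences between P1, P2 and their
    restrictions to the line.\<close>
  define R1 where "R1 f = cst a0 * d2 f - 2 * t1 * d1 (d2 f) - (t2 + 1) * d2 (d2 f)" for f
  define R2 where "R2 f = 2 * (t1 - 1) * (cst a0 * d1 (d2 f) - (t2 + 1) * d1 (d2 (d2 f)))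
    - 2 * ((1 - t2^2) * d1 (d2 (d2 f)) + cst a0 * t2 * d1 (d2 f) + cst a1 * d1 f
        + (1 - t1^2) * d1 (d1 (d2 f)) + cst a0 * t1 * d1 (d2 f) + cst a2 * d2 f)
    - cst (2 + a0) * (cst a0 * d2 f - (t2 + 1) * d2 (d2 f))" for f
  define Q where "Q f = A (R1 f) + B (R2 f)" for f
  have h: "h * 2 = 1"
    by (simp add: h_def cst_def numeral_poly one_pCons)
  have P1: "P1 a0 a1 a2 a3 f = pol.restr1 a0 a3 f (d2 f) + s * R1 f" for f
    unfolding P1_def pol.restr1_def pol.lead1_def pol_x pol_c R1_def s_def by (simp; algebra)
  have cst: "cst (2 + a0) = 2 + cst a0"
    by (simp flip: pol_c)
  have P2: "P2 a0 a1 a2 a3 f = pol.restr2 a0 a1 a2 f (d2 f) + s * R2 f" for f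
    unfolding P2_def pol.restr2_def pol.lead2_def pol_x pol_c R2_def s_def cst by (simp; algebra)
  have d1s: "d1 s = 0"
    by (simp add: s_def t2_def one_pCons)
  \<comment> \<open>A and B differentiate only in t1, hence commute with s.\<close>
  have A: "A (e + s * r) = A e + s * A r" and B: "B (e + s * r) = B e + s * B r" for e r
    unfolding A_def B_def pol.lead1_def pol.cofactor_def by (simp_all add: pol.D_simps d1s; algebra)+
  have "2 * (A e + B g) = pol.c (kappa a0 a2 0) * (pol.x - 1) * e
      - (pol.lead1 a0 0 (2 * g + pol.cofactor a0 0 e) + 2 * (2 * g + pol.cofactor a0 0 e))" for e g
    unfolding A_def B_def pol.lead1_def using h by (simp add: pol.D_simps) algebra
  then have "2 * (A (pol.restr1 a0 a3 f v) + B (pol.restr2 a0 a1 a2 f v)) = 2 * pol.act (Z a0 a1 a2 a3) f" for f v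
    unfolding pol.two_act_Z[of a0 a1 a2 a3 f v] by blast
  then have Z: "A (pol.restr1 a0 a3 f v) + B (pol.restr2 a0 a1 a2 f v) = pol.act (Z a0 a1 a2 a3) f" for f v
    by (metis mult_left_cancel zero_neq_numeral)
  have "A (P1 a0 a1 a2 a3 f) + B (P2 a0 a1 a2 a3 f) = op_t1 (Z a0 a1 a2 a3) f + s * (A (R1 f) + B (R2 f))" for f
    by (simp add: P1 P2 A B op_t1_eq_act distrib_left flip: Z[of f "d2 f"])
  then have eq: "(\<lambda>f. op_t1 (Z a0 a1 a2 a3) f + (t2 - 1) * Q f)
      = (\<lambda>f. (A \<circ> P1 a0 a1 a2 a3) f + (B \<circ> P2 a0 a1 a2 a3) f)"
    by (simp add: fun_eq_iff Q_def s_def)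
  have AB: "A \<in> weyl2" "B \<in> weyl2"
    unfolding A_def[abs_def] B_def[abs_def] pol.lead1_def pol.cofactor_def by (intro weyl2_intros)+
  have R: "R1 \<in> weyl2" "R2 \<in> weyl2"
    unfolding R1_def[abs_def] R2_def[abs_def] by (intro weyl2_intros)+
  have "C \<circ> R \<in> weyl2" if "C \<in> weyl2" "R \<in> weyl2" for C R
    using that unfolding weyl2_def by (rule diff_ops.comp)
  from this[OF AB(1) R(1)] this[OF AB(2) R(2)]
  have "Q \<in> weyl2"
    unfolding Q_def[abs_def] o_def by (rule weyl2_intros)
  moreover have "(\<lambda>f. (A \<circ> P1 a0 a1 a2 a3) f + (B \<circ> P2 a0 a1 a2 a3) f) \<in> Z2 a0 a1 a2 a3"
    unfolding Z2_def using AB by (intro left_ideal.add left_ideal.lmult left_ideal.gen) auto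
  ultimately show ?thesis
    unfolding restriction_def mem_Collect_eq eq[symmetric] by (intro bexI[of _ Q])
qed

section \<open>Leading coefficient and shape of Z(a)\<close>

definition lead_Z :: "complex poly" where
  "lead_Z = 2 * ([:0, 1:] + 1)^2 * ([:0, 1:] - 1)^3"

lemma lead_Z_nonzero: "lead_Z \<noteq> 0"
  by (auto simp: lead_Z_def one_pCons)

lemma degree_lead_Z: "degree lead_Z = 5"
  by (simp add: lead_Z_def one_pCons degree_mult_eq degree_power_eq numeral_poly)

lemma order_lead_Z: "order x lead_Z = (if x = 1 then 3 else if x = - 1 then 2 else 0)"
proof -
  have "order x ([:- a, 1:] ^ n) = (if x = a then n else 0)" for a n
    by (simp add: order_power_n_n order_0I)
  from this[of "- 1" 2] this[of 1 3] have "order x ([:1, 1:] ^ 2) = (if x = - 1 then 2 else 0)"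
    "order x ([:- 1, 1:] ^ 3) = (if x = 1 then 3 else 0)"
    by simp_all
  moreover have "lead_Z = smult 2 ([:1, 1:] ^ 2 * [:- 1, 1:] ^ 3)"
    by (simp add: lead_Z_def one_pCons numeral_poly)
  then have "order x lead_Z = order x ([:1, 1:] ^ 2 * [:- 1, 1:] ^ 3)"
    by (metis order_smult zero_neq_numeral)
  moreover have "order x ([:1, 1:] ^ 2 * [:- 1, 1:] ^ 3)
      = order x ([:1, 1:] ^ 2) + order x ([:- 1, 1:] ^ 3)"
    by (rule order_mult) simp
  ultimately show ?thesis
    by simp
qed

text \<open>Fuchs' criterion and the exponents depend on the lower coefficients only through these
  degrees and divisibilities, which survive adding a constant to q4.\<close>

lemma Z_shape:
  obtains q1 q2 q3 q4 where "Z a0 a1 a2 a3 = [:q4, q3, q2, q1, lead_Z:]"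
    "degree q1 \<le> 4" "degree q2 \<le> 3" "degree q3 \<le> 2" "degree q4 \<le> 1"
    "[:- 1, 1:]^2 dvd q1" "[:1, 1:] dvd q1" "[:- 1, 1:] dvd q2"
proof -
  have t: "[:- 1, 1:] = [:0, 1:] - (1 :: complex poly)" "[:1, 1:] = [:0, 1:] + (1 :: complex poly)"
    by (simp_all add: one_pCons)
  show thesis
    apply (rule that)
    unfolding Z_def Let_def lead_Z_def t
    apply (rule refl)
    apply (simp_all add: one_pCons numeral_poly power2_eq_square degree_pCons_eq_if)[4]
    by (intro dvd_mult2 dvd_mult dvd_refl)+
qed

text \<open>t = 0 is an ordinary point: p0 takes the value -2 there.\<close>

lemma coeff_lead_coeff_Z_0: "coeff (lead_coeff (Z a0 a1 a2 a3)) 0 \<noteq> 0"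
proof -
  obtain q1 q2 q3 q4 where "Z a0 a1 a2 a3 = [:q4, q3, q2, q1, lead_Z:]"
    by (rule Z_shape)
  then show ?thesis
    by (simp add: lead_Z_nonzero) (simp add: lead_Z_def coeff_mult_0 coeff_0_power numeral_poly)
qed

lemma left_ideal_restriction:
  assumes "\<And>k. kappa a0 a2 k \<noteq> 0"
  shows "left_ideal rat_ops (op_rat ` restriction a0 a1 a2 a3)
    = left_ideal rat_ops {op_rat (Z a0 a1 a2 a3)}"
proof (intro equalityI subsetI)
  have gen: "op_rat P \<in> left_ideal rat_ops {op_rat (Z a0 a1 a2 a3)}" if P: "P \<in> restriction a0 a1 a2 a3" for P
    unfolding op_rat_eq_act
  proof (rule left_multiple_if_solutions[OF coeff_lead_coeff_Z_0])
    fix u assume "ser.act (Z a0 a1 a2 a3) u = 0"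
    with fps_solution_exists[OF assms] obtain F
      where "F $ 0 = u" "P1_fps a0 a3 F = 0" "P2_fps a0 a1 a2 F = 0"
      by blast
    with restriction_annihilates[OF P extends_P1 _ extends_P2] show "ser.act P u = 0"
      by blast
  qed
  show "C \<in> left_ideal rat_ops {op_rat (Z a0 a1 a2 a3)}"
    if "C \<in> left_ideal rat_ops (op_rat ` restriction a0 a1 a2 a3)" for C
    using that by induction (blast intro: gen left_ideal.intros)+
  show "C \<in> left_ideal rat_ops (op_rat ` restriction a0 a1 a2 a3)"
    if "C \<in> left_ideal rat_ops {op_rat (Z a0 a1 a2 a3)}" for C
    using that by induction (blast intro: Z_in_restriction left_ideal.intros)+
qed

section \<open>Genericity\<close>

lemma generically_mono:
  assumes "generically R" "\<And>a0 a1 a2 a3. R a0 a1 a2 a3 \<Longrightarrow> R' a0 a1 a2 a3"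
  shows "generically R'"
  using assms(1) unfolding generically_def by (elim ex_forward conj_forward) (blast intro: assms(2))+

lemma generically_kappa_nonzero: "generically (\<lambda>a0 a1 a2 a3. \<forall>k. kappa a0 a2 k \<noteq> 0)"
  unfolding generically_def
proof (intro exI conjI allI impI)
  \<comment> \<open>This is a0^2 + 2 a0 + 4 a2 - 4 k (k + 1), the expansion of kappa_k, monic in a0
    and therefore nonzero.\<close>
  define F :: "nat \<Rightarrow> complex poly poly poly poly" where
    "F k = [:[:[:[:- 4 * of_nat k * (of_nat k + 1):], [:4:]:]:], 2, 1:]" for k
  show "countable (range F)"
    by simp
  show "0 \<notin> range F"
    by (auto simp: F_def)
  fix a0 a1 a2 a3 k
  assume "\<forall>F\<in>range F. eval4 F a0 a1 a2 a3 \<noteq> 0"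
  moreover have "eval4 (F k) a0 a1 a2 a3 = kappa a0 a2 k"
    by (simp add: F_def eval4_def kappa_def algebra_simps)
  ultimately show "kappa a0 a2 k \<noteq> 0"
    by auto
qed

section \<open>Local exponents\<close>

text \<open>p0 has order 3 at 1 and order 2 at -1, which leaves conditions only on q1 and q2; q3 and
  q4 may have poles of order 3 and 4 after division.\<close>

lemma fuchsianI:
  assumes L: "L = [:q4, q3, q2, q1, lead_Z:]"
    and deg: "degree q1 \<le> 4" "degree q2 \<le> 3" "degree q3 \<le> 2" "degree q4 \<le> 1"
    and dvd: "[:- 1, 1:]^2 dvd q1" "[:1, 1:] dvd q1" "[:- 1, 1:] dvd q2"
  shows "fuchsian L"
  unfolding fuchsian_def
proof (intro conjI allI impI)
  have degL: "degree L = 4"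
    by (simp add: L lead_Z_nonzero)
  show "L \<noteq> 0"
    by (simp add: L lead_Z_nonzero)
  fix i assume i: "i \<le> degree L" and nz: "coeff L i \<noteq> 0"
  have cases: "i = 0 \<or> i = 1 \<or> i = 2 \<or> i = 3 \<or> i = 4"
    using i degL by linarith
  have lead: "lead_coeff L = lead_Z"
    by (simp add: L lead_Z_nonzero)
  show "degree (coeff L i) + (degree L - i) \<le> degree (lead_coeff L)"
    using cases deg unfolding lead degL degree_lead_Z by (auto simp: L degree_lead_Z eval_nat_numeral)
  fix x
  have "q1 \<noteq> 0 \<Longrightarrow> 2 \<le> order 1 q1" "q1 \<noteq> 0 \<Longrightarrow> 1 \<le> order (- 1) q1" "q2 \<noteq> 0 \<Longrightarrow> 1 \<le> order 1 q2"
    using dvd order_divides[of 1 2 q1] order_divides[of "- 1" 1 q1] order_divides[of 1 1 q2] by auto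
  then show "order x (lead_coeff L) \<le> order x (coeff L i) + (degree L - i)"
    using cases nz unfolding lead degL order_lead_Z by (auto simp: L order_lead_Z eval_nat_numeral)
qed

lemma coeff_falling: "i \<le> n \<Longrightarrow> coeff (falling i) n = (if i = n then 1 else 0)"
proof -
  assume "i \<le> n"
  have "degree (falling i) = i"
    unfolding falling_def by (subst degree_prod_eq_sum_degree) auto
  moreover have "lead_coeff (falling i) = 1"
    unfolding falling_def lead_coeff_prod by simp
  ultimately show ?thesis
    using \<open>i \<le> n\<close> by (auto simp: coeff_eq_0)
qed

text \<open>Falling factorials are monic, so s^n comes from the leading coefficient of L alone. Its
  Taylor coefficients thus certify nonzero terms of the expansion.\<close>

lemma coeff_frobenius:
  assumes "degree L = n"
  shows "coeff (frobenius L x k) n = coeff (pcompose (lead_coeff L) [:x, 1:]) k"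
proof -
  have "coeff (frobenius L x k) n = (\<Sum>i\<le>n. if i = n then coeff (pcompose (coeff L i) [:x, 1:]) k else 0)"
    unfolding frobenius_def coeff_sum assms
    by (intro sum.cong) (auto simp: coeff_falling)
  then show ?thesis
    using assms by simp
qed

text \<open>The added constant enters with i = 0 at Taylor index k - n, so it is visible only for k
  = n.\<close>

lemma frobenius_add_const:
  assumes "degree L = n" "n > 0" "k \<noteq> n"
  shows "frobenius (L + [:[:c:]:]) x k = frobenius L x k"
proof -
  have deg: "degree (L + [:[:c:]:]) = n"
    using assms by (simp add: degree_add_eq_left)
  have "coeff (pcompose (coeff (L + [:[:c:]:]) i) [:x, 1:]) (k + i - n)
      = coeff (pcompose (coeff L i) [:x, 1:]) (k + i - n)" if "n \<le> k + i" for i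
    using that assms(3) by (cases i) (auto simp: pcompose_add coeff_pCons split: nat.split)
  then show ?thesis
    unfolding frobenius_def deg assms(1) by (intro sum.cong) auto
qed

text \<open>p0 has order at most 3 at every point; so the indicial polynomial is found at some k <
  4.\<close>

lemma pcompose_lead_Z_coeff: "\<exists>k<4. coeff (pcompose lead_Z [:x, 1:]) k \<noteq> 0"
proof (rule ccontr)
  assume "\<not> ?thesis"
  then have "monom 1 4 dvd pcompose lead_Z [:x, 1:]"
    unfolding monom_1_dvd_iff' by blast
  \<comment> \<open>Translating back by -x turns divisibility by t^4 into divisibility of p0 by (t -
    x)^4.\<close>
  then obtain r where "pcompose lead_Z [:x, 1:] = [:0, 1:] ^ 4 * r"
    unfolding monom_altdef dvd_def by (metis smult_1_left)
  then have "pcompose (pcompose lead_Z [:x, 1:]) [:- x, 1:] = pcompose ([:0, 1:] ^ 4 * r) [:- x, 1:]"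
    by simp
  also have "pcompose (pcompose lead_Z [:x, 1:]) [:- x, 1:] = lead_Z"
    by (simp add: pcompose_pCons flip: pcompose_assoc)
  also have "pcompose ([:0, 1:] ^ 4 * r) [:- x, 1:] = [:- x, 1:] ^ 4 * pcompose r [:- x, 1:]"
    by (simp only: pcompose_mult power4_eq_xxxx pcompose_pCons pcompose_0 pCons_0_0 add_0_left
        mult_zero_right add_0_right) (simp add: power4_eq_xxxx pcompose_pCons)
  finally have "lead_Z = [:- x, 1:] ^ 4 * pcompose r [:- x, 1:]" .
  then have "[:- x, 1:] ^ 4 dvd lead_Z"
    by (rule dvdI)
  then have "4 \<le> order x lead_Z"
    using order_divides[of x 4 lead_Z] lead_Z_nonzero by simp
  then show False
    unfolding order_lead_Z by (cases "x = 1"; cases "x = -1") auto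
qed

lemma local_exponents_add_const:
  "local_exponents (Z a0 a1 a2 a3 + [:[:c:]:]) x = local_exponents (Z a0 a1 a2 a3) x"
proof -
  obtain q1 q2 q3 q4 where Z: "Z a0 a1 a2 a3 = [:q4, q3, q2, q1, lead_Z:]"
    by (rule Z_shape)
  define L where "L = Z a0 a1 a2 a3"
  have deg: "degree L = 4" and lead: "lead_coeff L = lead_Z"
    by (simp_all add: L_def Z lead_Z_nonzero)
  have eq: "frobenius (L + [:[:c:]:]) x k = frobenius L x k" if "k < 4" for k
    using frobenius_add_const[OF deg] that by simp
  obtain k where k: "k < 4" "frobenius L x k \<noteq> 0"
    using pcompose_lead_Z_coeff[of x] coeff_frobenius[OF deg, of x] by (auto simp: lead) (metis coeff_0)
  define m where "m = (LEAST k. frobenius L x k \<noteq> 0)"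
  have "m \<le> k"
    unfolding m_def using k by (intro Least_le)
  have m: "frobenius L x m \<noteq> 0"
    unfolding m_def using k by (rule_tac LeastI)
  have "(LEAST k. frobenius (L + [:[:c:]:]) x k \<noteq> 0) = m"
  proof (rule Least_equality)
    show "frobenius (L + [:[:c:]:]) x m \<noteq> 0"
      using m eq \<open>m \<le> k\<close> k(1) by simp
    fix l assume "frobenius (L + [:[:c:]:]) x l \<noteq> 0"
    then show "m \<le> l"
      using eq[of l] \<open>m \<le> k\<close> k(1) Least_le[of "\<lambda>k. frobenius L x k \<noteq> 0" l] unfolding m_def by (cases "l < 4") auto
  qed
  then show ?thesis
    using eq[of m] \<open>m \<le> k\<close> k(1) by (simp add: local_exponents_def indicial_def L_def m_def)
qed

lemma local_exponents_infinity_add_const: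
  "local_exponents_infinity (Z a0 a1 a2 a3 + [:[:c:]:]) = local_exponents_infinity (Z a0 a1 a2 a3)"
proof -
  obtain q1 q2 q3 q4 where Z: "Z a0 a1 a2 a3 = [:q4, q3, q2, q1, lead_Z:]"
    and q: "degree q1 \<le> 4" "degree q2 \<le> 3" "degree q3 \<le> 2" "degree q4 \<le> 1"
    by (rule Z_shape)
  define L where "L = Z a0 a1 a2 a3"
  have deg: "degree L = 4" and lead: "lead_coeff L = lead_Z"
    by (simp_all add: L_def Z lead_Z_nonzero)
  have eq: "frobenius (L + [:[:c:]:]) 0 k = frobenius L 0 k" if "k \<noteq> 4" for k
    using frobenius_add_const[OF deg] that by simp
  \<comment> \<open>The index 5 is the degree of p0; for k > 5, every Taylor index k + i - 4 exceeds
    the degree bound i + 1.\<close>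
  have "coeff (frobenius L 0 5) 4 = lead_coeff lead_Z"
    by (simp add: coeff_frobenius[OF deg] lead degree_lead_Z)
  then have 5: "frobenius L 0 5 \<noteq> 0"
    using lead_Z_nonzero by (metis coeff_0 leading_coeff_0_iff)
  have "degree (coeff L i) \<le> i + 1" if "i \<le> 4" for i
  proof -
    have "i = 0 \<or> i = 1 \<or> i = 2 \<or> i = 3 \<or> i = 4"
      using that by linarith
    then show ?thesis
      using q by (auto simp: L_def Z degree_lead_Z eval_nat_numeral)
  qed
  then have "coeff (coeff L i) (k + i - 4) = 0" if "i \<le> 4" "5 < k" for i k
    using that by (intro coeff_eq_0) (rule le_less_trans[of _ "i + 1"], auto)
  then have 0: "frobenius L 0 k = 0" if "5 < k" for k
    using that by (auto simp: frobenius_def deg intro!: sum.neutral)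
  have "(GREATEST k. frobenius L 0 k \<noteq> 0) = 5"
    using 5 0 by (intro Greatest_equality) (auto simp: not_less[symmetric])
  moreover have "(GREATEST k. frobenius (L + [:[:c:]:]) 0 k \<noteq> 0) = 5"
    using 5 0 eq by (intro Greatest_equality) (auto simp: not_less[symmetric])
  ultimately show ?thesis
    using eq[of 5] by (simp add: local_exponents_infinity_def indicial_infinity_def L_def)
qed

lemma fuchsian_Z_add_const: "fuchsian (Z a0 a1 a2 a3 + [:[:c:]:])"
proof -
  obtain q1 q2 q3 q4 where "Z a0 a1 a2 a3 = [:q4, q3, q2, q1, lead_Z:]"
    "degree q1 \<le> 4" "degree q2 \<le> 3" "degree q3 \<le> 2" "degree q4 \<le> 1"
    "[:- 1, 1:]^2 dvd q1" "[:1, 1:] dvd q1" "[:- 1, 1:] dvd q2"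
    by (rule Z_shape)
  then show ?thesis
    by (intro fuchsianI[of _ "q4 + [:c:]" q3 q2 q1]) (auto intro: degree_add_le)
qed

theorem theorem4p2:
  shows "generically (\<lambda>a0 a1 a2 a3.
    left_ideal rat_ops (op_rat ` restriction a0 a1 a2 a3)
      = left_ideal rat_ops {op_rat (Z a0 a1 a2 a3)} \<and>
    (\<forall>c. fuchsian (Z a0 a1 a2 a3 + [:[:c:]:]) \<and>
      (\<forall>x. local_exponents (Z a0 a1 a2 a3 + [:[:c:]:]) x = local_exponents (Z a0 a1 a2 a3) x) \<and>
      local_exponents_infinity (Z a0 a1 a2 a3 + [:[:c:]:])
        = local_exponents_infinity (Z a0 a1 a2 a3)))"
  using generically_kappa_nonzero
  by (rule generically_mono)
    (simp add: left_ideal_restriction fuchsian_Z_add_const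
      local_exponents_add_const local_exponents_infinity_add_const)

end
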